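(* Let $\alpha$ be a negative rational number. Then for $a^*,b^*,c^*,d^*,e^*,f^*,x^*,y^* \in \mathbb{R}^3$ sufficiently general, the system of six equations \[ \|x-t^*\|^\alpha + \|y-t^*\|^\alpha = \|x^*-t^*\|^\alpha + \|y^*-t^*\|^\alpha \quad \text{for } t^*\in\{a^*,b^*,c^*,d^*,e^*,f^*\} \] in the six unknowns $x=(x_1,x_2,x_3)$, $y=(y_1,y_2,y_3)$, with $x_1,x_2,x_3,y_1,y_2,y_3 \in \mathbb{R}$, has only finitely many solutions.
   Context: $\|\cdot\|$ denotes the Euclidean norm on $\mathbb{R}^3$. "Sufficiently general" means: for all choices of the points outside some proper (lower-dimensional) algebraic subset of the parameter space $(\mathbb{R}^3)^8$, i.e. for a generic choice. *)

theory Defs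
  imports "HOL-Analysis.Analysis"
begin

inductive_set polyfun :: "(real^'m^'n \<Rightarrow> real) set" where
  const: "(\<lambda>v. c) \<in> polyfun"
| coord: "(\<lambda>v. v $ j $ i) \<in> polyfun"
| add: "p \<in> polyfun \<Longrightarrow> q \<in> polyfun \<Longrightarrow> (\<lambda>v. p v + q v) \<in> polyfun"
| mult: "p \<in> polyfun \<Longrightarrow> q \<in> polyfun \<Longrightarrow> (\<lambda>v. p v * q v) \<in> polyfun"

text \<open>Parameter v: v$1,...,v$6 are a*,...,f*, v$7 = x*, v$8 = y*.
  Solutions (x,y) of the six equations; the equations only make sense when
  x and y differ from all the points t*.\<close>
definition sols :: "real \<Rightarrow> real^3^8 \<Rightarrow> ((real^3) \<times> (real^3)) set" where
  "sols \<alpha> v = {(x :: real^3, y :: real^3). \<forall>k \<in> {1,2,3,4,5,6::8}.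
      x \<noteq> v $ k \<and> y \<noteq> v $ k \<and>
      norm (x - v $ k) powr \<alpha> + norm (y - v $ k) powr \<alpha>
        = norm (v $ 7 - v $ k) powr \<alpha> + norm (v $ 8 - v $ k) powr \<alpha>}"

end

theory Submission
  imports Defs "HOL-Library.Function_Algebras" "HOL-Library.Set_Algebras"
begin

text \<open>
  Consider the incidence set of all \<open>(v, x, y)\<close> with \<open>(x, y)\<close> a solution for the parameters \<open>v\<close>. If
  \<open>{x, y} \<noteq> {x\<^sup>*, y\<^sup>*}\<close> and \<open>x\<^sup>* \<noteq> y\<^sup>*\<close>, one of the four points \<open>z = (x, y, x\<^sup>*, y\<^sup>*)\<close>, say \<open>z\<^sub>0\<close>, differs from
  the other three. Since \<open>\<alpha> < 0\<close>, the equation for a point \<open>t\<close> fails near \<open>t = z\<^sub>0\<close>, so for fixed \<open>z\<close> each of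
  the six points \<open>t\<close> is confined to a surface. Hence the incidence set has dimension \<open>12 + 6 \<cdot> 2 = 24\<close>, and
  the 25 functions given by the 24 coordinates of \<open>v\<close> and one coordinate of a solution are
  algebraically dependent on it. A nonzero coefficient of such a dependence, as a polynomial in
  the solution coordinate, is a polynomial in \<open>v\<close> off which that coordinate takes finitely many values.

  The dimension count is done with Hilbert functions. Put \<open>\<tau> = t - z\<^sub>0\<close> and \<open>\<sigma>\<^sub>j = |z\<^sub>j - t|\<^bsup>-\<alpha>\<^esup>\<close>, whose \<open>n\<close>-th
  powers are polynomials for suitable \<open>n\<close>. The equation \<open>\<Sum>\<^sub>j \<plusminus>1/\<sigma>\<^sub>j = 0\<close> yields
  \<open>c = \<Sum>\<^sub>l \<tau>\<^sub>l h\<^sub>l\<close> with \<open>c\<close> a nonvanishing polynomial in \<open>z\<close> alone and \<open>h\<^sub>l\<close> polynomials in \<open>z, \<tau>, \<sigma>\<close>. After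
  multiplication by a power of \<open>c\<close>, monomials in \<open>\<tau>\<close> of degree at most \<open>D\<close> in each variable
  are therefore combinations, with coefficients polynomial in \<open>z\<close>, of only \<open>O(D\<^sup>2)\<close> functions.
\<close>

subsection \<open>Spans of monomials\<close>

lemma span_times:
  fixes A B :: "'a::real_algebra set"
  assumes "f \<in> span A" "g \<in> span B"
  shows "f * g \<in> span (A * B)"
  using assms(1)
proof (induction rule: span_induct_alt)
  case base
  show ?case by (simp add: span_zero)
next
  case (step c x y)
  have "x * g \<in> span (A * B)"
    using assms(2)
  proof (induction rule: span_induct_alt)
    case base
    show ?case by (simp add: span_zero)
  next
    case (step d u v)
    have "x * u \<in> A * B" using step \<open>x \<in> A\<close> by (simp add: set_times_intro)
    then show ?case
      using step by (simp add: distrib_left span_add span_base span_scale)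
  qed
  then show ?case
    using step by (simp add: distrib_right span_add span_scale)
qed

lemma span_prod_mem:
  fixes F :: "'k \<Rightarrow> 'a::{comm_ring_1,real_algebra_1} set"
  assumes "\<And>k. k \<in> K \<Longrightarrow> f k \<in> span (F k)"
  shows "(\<Prod>k\<in>K. f k) \<in> span (\<Prod>k\<in>K. F k)"
  using assms
proof (induction K rule: infinite_finite_induct)
  case (infinite K)
  then show ?case by (simp add: span_base)
next
  case empty
  then show ?case by (simp add: span_base)
next
  case (insert k K)
  then show ?case by (simp add: span_times)
qed

lemma set_times_subset_span:
  fixes A :: "'a::real_algebra set"
  assumes "A \<subseteq> span A'" "B \<subseteq> span B'"
  shows "A * B \<subseteq> span (A' * B')"
  using assms by (auto elim!: set_times_elim intro: span_times)

lemma finite_card_set_times: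
  fixes A B :: "'a::times set"
  assumes "finite A" "finite B"
  shows "finite (A * B)" "card (A * B) \<le> card A * card B"
proof -
  have eq: "A * B = (\<lambda>(a, b). a * b) ` (A \<times> B)"
    by (auto simp: set_times_def)
  show "finite (A * B)" unfolding eq using assms by simp
  show "card (A * B) \<le> card A * card B"
    unfolding eq using card_image_le[of "A \<times> B" "\<lambda>(a, b). a * b"] assms
    by (simp add: card_cartesian_product)
qed

lemma dependent_family:
  fixes f :: "'i \<Rightarrow> 'a::real_vector"
  assumes "finite I" "finite T" "\<And>i. i \<in> I \<Longrightarrow> f i \<in> span T" "card T < card I"
  obtains c where "\<exists>i\<in>I. c i \<noteq> 0" "(\<Sum>i\<in>I. c i *\<^sub>R f i) = 0"
proof (cases "inj_on f I")
  case False
  then obtain i j where ij: "i \<in> I" "j \<in> I" "i \<noteq> j" "f i = f j"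
    by (auto simp: inj_on_def)
  define c :: "'i \<Rightarrow> real" where "c = (\<lambda>k. if k = i then 1 else if k = j then - 1 else 0)"
  have "(\<Sum>k\<in>I. c k *\<^sub>R f k) = (\<Sum>k\<in>{i, j}. c k *\<^sub>R f k)"
    using ij assms(1) by (intro sum.mono_neutral_right) (auto simp: c_def)
  also have "\<dots> = 0" using ij by (simp add: c_def)
  finally have "(\<Sum>k\<in>I. c k *\<^sub>R f k) = 0" .
  moreover have "c i \<noteq> 0" by (simp add: c_def)
  ultimately show ?thesis using that ij by blast
next
  case True
  have "dependent (f ` I)"
  proof (rule ccontr)
    assume "\<not> dependent (f ` I)"
    then have "card (f ` I) \<le> card T"
      using independent_span_bound[of T "f ` I"] assms by auto
    then show False using assms(4) card_image[OF True] by simp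
  qed
  then obtain u where u: "\<exists>v\<in>f ` I. u v \<noteq> 0" "(\<Sum>v\<in>f ` I. u v *\<^sub>R v) = 0"
    using assms(1) dependent_finite[of "f ` I"] by auto
  show ?thesis
    using u sum.reindex[OF True, of "\<lambda>v. u v *\<^sub>R v"] that[of "u \<circ> f"] by auto
qed

definition pmonom :: "('i::finite \<Rightarrow> 'a::comm_ring_1) \<Rightarrow> ('i \<Rightarrow> nat) \<Rightarrow> 'a" where
  "pmonom g e = (\<Prod>i\<in>UNIV. g i ^ e i)"

definition pmonoms :: "('i::finite \<Rightarrow> 'a::comm_ring_1) \<Rightarrow> nat \<Rightarrow> 'a set" where
  "pmonoms g d = {pmonom g e | e. \<forall>i. e i \<le> d}"

lemma pmonom_add: "pmonom g e * pmonom g e' = pmonom g (\<lambda>i. e i + e' i)"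
  by (simp add: pmonom_def power_add prod.distrib)

lemma pmonom_zero: "pmonom g (\<lambda>_. 0) = 1"
  by (simp add: pmonom_def)

lemma pmonom_upd:
  "g i ^ k * pmonom g e = pmonom g (e(i := e i + k))"
proof -
  have "pmonom g (e(i := e i + k)) = (\<Prod>j\<in>UNIV. (if j = i then g i ^ k else 1) * g j ^ e j)"
    unfolding pmonom_def by (intro prod.cong) (auto simp: power_add)
  then show ?thesis
    by (simp add: prod.distrib pmonom_def)
qed

lemma pmonom_single: "pmonom g (\<lambda>j. if j = i then k else 0) = g i ^ k"
  using pmonom_upd[of g i k "\<lambda>_. 0"] by (simp add: pmonom_zero fun_upd_def)

lemma pmonomsI: "(\<And>i. e i \<le> d) \<Longrightarrow> pmonom g e \<in> pmonoms g d"
  by (auto simp: pmonoms_def)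

lemma pmonoms_mono: "a \<le> b \<Longrightarrow> pmonoms g a \<subseteq> pmonoms g b"
  unfolding pmonoms_def by (blast intro: le_trans)

lemma one_in_pmonoms: "1 \<in> pmonoms g d"
  using pmonomsI[of "\<lambda>_. 0" d g] by (simp add: pmonom_zero)

lemma gen_in_pmonoms: "g i \<in> pmonoms g (Suc d)"
  using pmonomsI[of "\<lambda>j. if j = i then 1 else 0" "Suc d" g] by (simp add: pmonom_single)

lemma pmonoms_times: "pmonoms g a * pmonoms g b \<subseteq> pmonoms g (a + b)"
proof
  fix x assume "x \<in> pmonoms g a * pmonoms g b"
  then obtain e e' where "x = pmonom g e * pmonom g e'" "\<forall>i. e i \<le> a" "\<forall>i. e' i \<le> b"
    by (auto simp: pmonoms_def elim!: set_times_elim)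
  then show "x \<in> pmonoms g (a + b)"
    by (auto simp: pmonom_add add_mono intro!: pmonomsI)
qed

lemma finite_card_pmonoms:
  fixes g :: "'i::finite \<Rightarrow> 'a::comm_ring_1"
  shows "finite (pmonoms g d)" "card (pmonoms g d) \<le> (d + 1) ^ CARD('i)"
proof -
  have eq: "pmonoms g d = pmonom g ` (PiE UNIV (\<lambda>_. {..d}))"
    by (auto simp: pmonoms_def PiE_def)
  show "finite (pmonoms g d)" unfolding eq by (intro finite_imageI finite_PiE) auto
  have "card (pmonoms g d) \<le> card (PiE (UNIV::'i set) (\<lambda>_. {..d}))"
    unfolding eq by (intro card_image_le finite_PiE) auto
  then show "card (pmonoms g d) \<le> (d + 1) ^ CARD('i)"
    by (simp add: card_PiE)
qed

inductive_set polys :: "'a::real_algebra_1 set \<Rightarrow> 'a set" for G where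
  const: "of_real c \<in> polys G"
| gen: "g \<in> G \<Longrightarrow> g \<in> polys G"
| add: "f \<in> polys G \<Longrightarrow> g \<in> polys G \<Longrightarrow> f + g \<in> polys G"
| mult: "f \<in> polys G \<Longrightarrow> g \<in> polys G \<Longrightarrow> f * g \<in> polys G"

lemma polys_mono: "G \<subseteq> H \<Longrightarrow> f \<in> polys G \<Longrightarrow> f \<in> polys H"
  by (rotate_tac, induction rule: polys.induct) (auto intro: polys.intros)

lemma polys_1: "1 \<in> polys G"
  using polys.const[of 1 G] by simp

lemma polys_0: "0 \<in> polys G"
  using polys.const[of 0 G] by simp

lemma polys_uminus: "f \<in> polys G \<Longrightarrow> - f \<in> polys G"
  using polys.mult[OF polys.const[of "-1" G], of f] by simp

lemma polys_diff: "f \<in> polys G \<Longrightarrow> g \<in> polys G \<Longrightarrow> f - g \<in> polys G"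
  using polys.add[of f G "- g"] polys_uminus[of g G] by simp

lemma polys_power: "f \<in> polys G \<Longrightarrow> f ^ k \<in> polys G"
  by (induction k) (auto intro: polys_1 polys.mult)

lemma polys_sum: "(\<And>i. i \<in> I \<Longrightarrow> f i \<in> polys G) \<Longrightarrow> (\<Sum>i\<in>I. f i) \<in> polys G"
  by (induction I rule: infinite_finite_induct) (auto intro: polys_0 polys.add)

lemma polys_prod:
  fixes f :: "'i \<Rightarrow> 'a::{comm_ring_1,real_algebra_1}"
  shows "(\<And>i. i \<in> I \<Longrightarrow> f i \<in> polys G) \<Longrightarrow> (\<Prod>i\<in>I. f i) \<in> polys G"
  by (induction I rule: infinite_finite_induct) (auto intro: polys_1 polys.mult)

lemma polys_filtration:
  fixes X :: "nat \<Rightarrow> 'a::{comm_ring_1,real_algebra_1} set"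
  assumes mono: "\<And>a b. a \<le> b \<Longrightarrow> X a \<subseteq> X b"
    and one: "1 \<in> X 0"
    and times: "\<And>a b. X a * X b \<subseteq> X (a + b)"
    and gens: "\<And>g. g \<in> G \<Longrightarrow> \<exists>d. g \<in> span (X d)"
    and f: "f \<in> polys G"
  shows "\<exists>d. f \<in> span (X d)"
  using f
proof induction
  case (const c)
  then show ?case using one by (metis of_real_def span_base span_scale)
next
  case (gen g)
  then show ?case using gens by auto
next
  case (add f g)
  then obtain a b where "f \<in> span (X a)" "g \<in> span (X b)" by auto
  then have "f \<in> span (X (a + b))" "g \<in> span (X (a + b))"
    using span_mono[OF mono[of a "a + b"]] span_mono[OF mono[of b "a + b"]] by auto
  then show ?case by (auto intro: span_add)
next
  case (mult f g)
  then obtain a b where "f \<in> span (X a)" "g \<in> span (X b)" by auto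
  then have "f * g \<in> span (X (a + b))"
    using span_times span_mono[OF times] by blast
  then show ?case ..
qed

lemma pmonoms_pair_times:
  "(pmonoms g a * pmonoms h a) * (pmonoms g b * pmonoms h b)
    \<subseteq> pmonoms g (a + b) * pmonoms h (a + b)"
proof -
  have "(pmonoms g a * pmonoms h a) * (pmonoms g b * pmonoms h b)
      = (pmonoms g a * pmonoms g b) * (pmonoms h a * pmonoms h b)"
    by (simp add: ac_simps)
  then show ?thesis
    using set_times_mono2[OF pmonoms_times pmonoms_times] by simp
qed

lemma polys_in_span_pmonoms:
  fixes \<zeta> :: "'z::finite \<Rightarrow> 'a::{comm_ring_1,real_algebra_1}"
  assumes "f \<in> polys (range \<zeta>)"
  shows "\<exists>d. f \<in> span (pmonoms \<zeta> d)"
proof (rule polys_filtration[where X = "pmonoms \<zeta>", OF pmonoms_mono one_in_pmonoms pmonoms_times _ assms])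
  fix g assume "g \<in> range \<zeta>"
  then show "\<exists>d. g \<in> span (pmonoms \<zeta> d)"
    using gen_in_pmonoms span_base by blast
qed

lemma polys_in_span_pmonoms2:
  fixes \<zeta> :: "'z::finite \<Rightarrow> 'a::{comm_ring_1,real_algebra_1}" and \<tau> :: "'l::finite \<Rightarrow> 'a"
  assumes "f \<in> polys (range \<zeta> \<union> range \<tau>)"
  shows "\<exists>d. f \<in> span (pmonoms \<zeta> d * pmonoms \<tau> d)"
proof (rule polys_filtration[where X = "\<lambda>d. pmonoms \<zeta> d * pmonoms \<tau> d", OF _ _ _ _ assms])
  show "pmonoms \<zeta> a * pmonoms \<tau> a \<subseteq> pmonoms \<zeta> b * pmonoms \<tau> b" if "a \<le> b" for a b
    using that by (intro set_times_mono2 pmonoms_mono)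
  show "1 \<in> pmonoms \<zeta> 0 * pmonoms \<tau> 0"
    using set_times_intro[OF one_in_pmonoms[of \<zeta> 0] one_in_pmonoms[of \<tau> 0]] by simp
  show "(pmonoms \<zeta> a * pmonoms \<tau> a) * (pmonoms \<zeta> b * pmonoms \<tau> b)
      \<subseteq> pmonoms \<zeta> (a + b) * pmonoms \<tau> (a + b)" for a b
    by (rule pmonoms_pair_times)
  fix g assume "g \<in> range \<zeta> \<union> range \<tau>"
  then have "g \<in> pmonoms \<zeta> 1 * pmonoms \<tau> 1"
    using set_times_intro[OF gen_in_pmonoms[of \<zeta> _ 0] one_in_pmonoms[of \<tau> 1]]
      set_times_intro[OF one_in_pmonoms[of \<zeta> 1] gen_in_pmonoms[of \<tau> _ 0]] by auto
  then show "\<exists>d. g \<in> span (pmonoms \<zeta> d * pmonoms \<tau> d)"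
    using span_base by blast
qed

lemma polys_in_span_pmonoms3:
  fixes \<zeta> :: "'z::finite \<Rightarrow> 'a::{comm_ring_1,real_algebra_1}"
    and \<tau> :: "'l::finite \<Rightarrow> 'a" and \<sigma> :: "'j::finite \<Rightarrow> 'a"
  assumes "f \<in> polys (range \<zeta> \<union> range \<tau> \<union> range \<sigma>)"
  shows "\<exists>d. f \<in> span (pmonoms \<zeta> d * pmonoms \<tau> d * pmonoms \<sigma> d)"
proof (rule polys_filtration[where X = "\<lambda>d. pmonoms \<zeta> d * pmonoms \<tau> d * pmonoms \<sigma> d",
      OF _ _ _ _ assms])
  show "pmonoms \<zeta> a * pmonoms \<tau> a * pmonoms \<sigma> a
      \<subseteq> pmonoms \<zeta> b * pmonoms \<tau> b * pmonoms \<sigma> b" if "a \<le> b" for a b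
    using that by (intro set_times_mono2 pmonoms_mono)
  show "1 \<in> pmonoms \<zeta> 0 * pmonoms \<tau> 0 * pmonoms \<sigma> 0"
    using set_times_intro[OF set_times_intro[OF one_in_pmonoms[of \<zeta> 0] one_in_pmonoms[of \<tau> 0]]
      one_in_pmonoms[of \<sigma> 0]] by simp
  show "(pmonoms \<zeta> a * pmonoms \<tau> a * pmonoms \<sigma> a) * (pmonoms \<zeta> b * pmonoms \<tau> b * pmonoms \<sigma> b)
      \<subseteq> pmonoms \<zeta> (a + b) * pmonoms \<tau> (a + b) * pmonoms \<sigma> (a + b)" for a b
  proof -
    have "(pmonoms \<zeta> a * pmonoms \<tau> a * pmonoms \<sigma> a) * (pmonoms \<zeta> b * pmonoms \<tau> b * pmonoms \<sigma> b)
      = ((pmonoms \<zeta> a * pmonoms \<tau> a) * (pmonoms \<zeta> b * pmonoms \<tau> b)) * (pmonoms \<sigma> a * pmonoms \<sigma> b)"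
      by (simp add: ac_simps)
    then show ?thesis
      using set_times_mono2[OF pmonoms_pair_times pmonoms_times] by simp
  qed
  fix g assume g: "g \<in> range \<zeta> \<union> range \<tau> \<union> range \<sigma>"
  have "g \<in> pmonoms \<zeta> 1 * pmonoms \<tau> 1 * pmonoms \<sigma> 1"
    using g
    set_times_intro[OF set_times_intro[OF gen_in_pmonoms[of \<zeta> _ 0] one_in_pmonoms[of \<tau> 1]] one_in_pmonoms[of \<sigma> 1]]
    set_times_intro[OF set_times_intro[OF one_in_pmonoms[of \<zeta> 1] gen_in_pmonoms[of \<tau> _ 0]] one_in_pmonoms[of \<sigma> 1]]
    set_times_intro[OF set_times_intro[OF one_in_pmonoms[of \<zeta> 1] one_in_pmonoms[of \<tau> 1]] gen_in_pmonoms[of \<sigma> _ 0]]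
    by auto
  then show "\<exists>d. g \<in> span (pmonoms \<zeta> d * pmonoms \<tau> d * pmonoms \<sigma> d)"
    using span_base by blast
qed

lemma finite_uniform_bound:
  fixes P :: "'b \<Rightarrow> nat \<Rightarrow> bool"
  assumes "finite S" "\<And>s. s \<in> S \<Longrightarrow> \<exists>d. P s d" "\<And>s a b. P s a \<Longrightarrow> a \<le> b \<Longrightarrow> P s b"
  shows "\<exists>d. \<forall>s\<in>S. P s d"
  using assms(1,2)
proof (induction S rule: finite_induct)
  case (insert s S)
  then obtain a b where "P s a" "\<forall>s\<in>S. P s b" by (meson insertCI)
  then show ?case
    using assms(3)[of _ a "a + b"] assms(3)[of _ b "a + b"] by (intro exI[of _ "a + b"]) auto
qed simp

lemma polys_reduce_roots:
  fixes \<zeta> :: "'z::finite \<Rightarrow> 'a::{comm_ring_1,real_algebra_1}"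
    and \<tau> :: "'l::finite \<Rightarrow> 'a" and \<sigma> :: "'j::finite \<Rightarrow> 'a"
  assumes f: "f \<in> polys (range \<zeta> \<union> range \<tau> \<union> range \<sigma>)" and n: "n > 0"
    and \<rho>: "\<And>j. \<sigma> j ^ n \<in> polys (range \<zeta> \<union> range \<tau>)"
  shows "\<exists>d. f \<in> span (pmonoms \<zeta> d * pmonoms \<tau> d * pmonoms \<sigma> (n - 1))"
proof -
  let ?V = "\<lambda>d. pmonoms \<zeta> d * pmonoms \<tau> d"
  have Vmono: "?V a \<subseteq> ?V b" if "a \<le> b" for a b
    using that by (intro set_times_mono2 pmonoms_mono)
  obtain d where d: "f \<in> span (?V d * pmonoms \<sigma> d)"
    using polys_in_span_pmonoms3[OF f] by auto
  have "\<exists>d'. \<forall>s\<in>pmonoms \<sigma> d. s \<in> span (?V d' * pmonoms \<sigma> (n - 1))"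
  proof (rule finite_uniform_bound)
    show "finite (pmonoms \<sigma> d)" by (rule finite_card_pmonoms)
    show "s \<in> span (?V b * pmonoms \<sigma> (n - 1))"
      if "s \<in> span (?V a * pmonoms \<sigma> (n - 1))" "a \<le> b" for s a b
      using that span_mono[OF set_times_mono2[OF Vmono[of a b] order_refl]] by blast
    fix s assume "s \<in> pmonoms \<sigma> d"
    then obtain e where s: "s = pmonom \<sigma> e" by (auto simp: pmonoms_def)
    have s': "s = (\<Prod>j\<in>UNIV. (\<sigma> j ^ n) ^ (e j div n)) * pmonom \<sigma> (\<lambda>j. e j mod n)"
      unfolding s pmonom_def prod.distrib[symmetric]
      by (intro prod.cong refl) (metis div_mult_mod_eq mult.commute power_add power_mult)
    have "(\<Prod>j\<in>UNIV. (\<sigma> j ^ n) ^ (e j div n)) \<in> polys (range \<zeta> \<union> range \<tau>)"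
      by (intro polys_prod polys_power \<rho>)
    from polys_in_span_pmonoms2[OF this]
    obtain d' where d': "(\<Prod>j\<in>UNIV. (\<sigma> j ^ n) ^ (e j div n)) \<in> span (?V d')" ..
    have "e j mod n \<le> n - 1" for j
      using mod_less_divisor[OF n, of "e j"] by linarith
    then have e: "pmonom \<sigma> (\<lambda>j. e j mod n) \<in> span (pmonoms \<sigma> (n - 1))"
      by (rule span_base[OF pmonomsI])
    show "\<exists>d'. s \<in> span (?V d' * pmonoms \<sigma> (n - 1))"
      unfolding s' using span_times[OF d' e] by (rule exI)
  qed
  then obtain d' where d': "pmonoms \<sigma> d \<subseteq> span (?V d' * pmonoms \<sigma> (n - 1))"
    by blast
  have "?V d * pmonoms \<sigma> d \<subseteq> span (?V d * (?V d' * pmonoms \<sigma> (n - 1)))"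
    using d' by (intro set_times_subset_span) (auto intro: span_base)
  also have "\<dots> \<subseteq> span (?V (d + d') * pmonoms \<sigma> (n - 1))"
    unfolding mult.assoc[symmetric, of "?V d" "?V d'" "pmonoms \<sigma> (n - 1)"]
    by (rule span_mono[OF set_times_mono2[OF pmonoms_pair_times order_refl]])
  finally have "span (?V d * pmonoms \<sigma> d) \<subseteq> span (?V (d + d') * pmonoms \<sigma> (n - 1))"
    by (rule span_minimal) simp
  then show ?thesis using d by blast
qed

lemma span_mult_left:
  fixes a :: "'a::real_algebra"
  assumes "x \<in> span S" "\<And>s. s \<in> S \<Longrightarrow> a * s \<in> span T"
  shows "a * x \<in> span T"
  using assms(1)
proof (induction rule: span_induct_alt)
  case base
  then show ?case by (simp add: span_zero)
next
  case (step c s y)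
  then show ?case using assms(2) by (simp add: distrib_left span_add span_scale)
qed

lemma power_in_span_pmonoms:
  fixes \<zeta> :: "'z::finite \<Rightarrow> 'a::{comm_ring_1,real_algebra_1}"
  assumes "c \<in> span (pmonoms \<zeta> b)"
  shows "c ^ r \<in> span (pmonoms \<zeta> (b * r))"
proof (induction r)
  case 0
  then show ?case by (simp add: span_base one_in_pmonoms)
next
  case (Suc r)
  then show ?case
    using span_times[OF assms Suc] span_mono[OF pmonoms_times[of \<zeta> b "b * r"]] by auto
qed

definition boundary_monoms ::
  "('l::finite \<Rightarrow> 'a::comm_ring_1) \<Rightarrow> 'a set \<Rightarrow> nat \<Rightarrow> nat \<Rightarrow> 'a set" where
  "boundary_monoms \<tau> S N D = {pmonom \<tau> m | m. (\<forall>l. m l \<le> D) \<and> (\<exists>l. D \<le> m l + N)} * S"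

lemma finite_card_boundary_monoms:
  fixes \<tau> :: "'l::finite \<Rightarrow> 'a::comm_ring_1"
  assumes "finite S"
  shows "finite (boundary_monoms \<tau> S N D)"
    "card (boundary_monoms \<tau> S N D) \<le> (CARD('l) * (N + 1) * card S) * (D + 1) ^ (CARD('l) - 1)"
proof -
  define E where "E = (\<Union>l::'l. PiE UNIV (\<lambda>i. if i = l then {D - N..D} else {..D}))"
  have finE: "finite E"
    unfolding E_def by (intro finite_UN_I finite_PiE) auto
  have card1: "card (PiE UNIV (\<lambda>i::'l. if i = l then {D - N..D} else {..D}))
      \<le> (N + 1) * (D + 1) ^ (CARD('l) - 1)" for l
  proof -
    have "card (PiE UNIV (\<lambda>i::'l. if i = l then {D - N..D} else {..D}))
        = (\<Prod>i\<in>UNIV. if i = l then D + 1 - (D - N) else D + 1)"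
      unfolding card_PiE[OF finite] by (intro prod.cong) auto
    also have "\<dots> = (D + 1 - (D - N)) * (D + 1) ^ (CARD('l) - 1)"
      by (subst prod.remove[of _ l]) (auto simp: prod.If_cases card_Diff_singleton)
    also have "\<dots> \<le> (N + 1) * (D + 1) ^ (CARD('l) - 1)"
      by (intro mult_right_mono) auto
    finally show ?thesis .
  qed
  have "card E \<le> (\<Sum>l\<in>(UNIV::'l set). card (PiE UNIV (\<lambda>i. if i = l then {D - N..D} else {..D})))"
    unfolding E_def by (rule card_UN_le) simp
  also have "\<dots> \<le> (\<Sum>l\<in>(UNIV::'l set). (N + 1) * (D + 1) ^ (CARD('l) - 1))"
    by (intro sum_mono card1)
  finally have cardE: "card E \<le> CARD('l) * ((N + 1) * (D + 1) ^ (CARD('l) - 1))"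
    by simp
  have sub: "{pmonom \<tau> m | m. (\<forall>l. m l \<le> D) \<and> (\<exists>l. D \<le> m l + N)} \<subseteq> pmonom \<tau> ` E"
  proof clarify
    fix m :: "'l \<Rightarrow> nat" and l assume "\<forall>l. m l \<le> D" "D \<le> m l + N"
    then have "m \<in> E" unfolding E_def by (intro UN_I[of l]) (auto simp: PiE_def)
    then show "pmonom \<tau> m \<in> pmonom \<tau> ` E" by (rule imageI)
  qed
  have fin: "finite {pmonom \<tau> m | m. (\<forall>l. m l \<le> D) \<and> (\<exists>l. D \<le> m l + N)}"
    using sub finE finite_subset by blast
  have "card {pmonom \<tau> m | m. (\<forall>l. m l \<le> D) \<and> (\<exists>l. D \<le> m l + N)} \<le> card (pmonom \<tau> ` E)"
    using finE sub by (intro card_mono) auto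
  also have "\<dots> \<le> card E" by (rule card_image_le[OF finE])
  finally have card: "card {pmonom \<tau> m | m. (\<forall>l. m l \<le> D) \<and> (\<exists>l. D \<le> m l + N)}
      \<le> CARD('l) * ((N + 1) * (D + 1) ^ (CARD('l) - 1))"
    using cardE by simp
  show "finite (boundary_monoms \<tau> S N D)"
    unfolding boundary_monoms_def by (rule finite_card_set_times(1)[OF fin assms])
  show "card (boundary_monoms \<tau> S N D) \<le> (CARD('l) * (N + 1) * card S) * (D + 1) ^ (CARD('l) - 1)"
    unfolding boundary_monoms_def
    using order_trans[OF finite_card_set_times(2)[OF fin assms] mult_right_mono[OF card, of "card S"]]
    by (simp only: ac_simps)
qed

text \<open>Multiplying by \<open>c\<close> trades \<open>1\<close> for monomials of higher degree in \<open>\<tau>\<close>; iterating pushes every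
  monomial of the box \<open>[0, D]\<^sup>l\<close> to a neighbourhood of its outer faces, which has one dimension less.\<close>

lemma push_to_boundary:
  fixes \<zeta> :: "'z::finite \<Rightarrow> 'a::{comm_ring_1,real_algebra_1}"
    and \<tau> :: "'l::finite \<Rightarrow> 'a" and S :: "'a set"
  assumes S: "1 \<in> S"
    and c: "c \<in> span (pmonoms \<zeta> b)" "c = (\<Sum>l\<in>UNIV. \<tau> l * h l)"
    and h: "\<And>l s. s \<in> S \<Longrightarrow> h l * s \<in> span (pmonoms \<zeta> b * pmonoms \<tau> N * S)"
    and m: "\<And>l. m l \<le> D"
  shows "c ^ (CARD('l) * D + 1) * pmonom \<tau> m
    \<in> span (pmonoms \<zeta> (b * (CARD('l) * D + 1)) * boundary_monoms \<tau> S N D)"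
proof -
  let ?R = "boundary_monoms \<tau> S N D"
  have main: "c ^ r * (pmonom \<tau> m * s) \<in> span (pmonoms \<zeta> (b * r) * ?R)"
    if "\<forall>l. m l \<le> D" "s \<in> S" "CARD('l) * D + 1 \<le> sum m UNIV + r" for r m s
    using that
  proof (induction r arbitrary: m s)
    case 0
    have "sum m UNIV \<le> CARD('l) * D"
      using sum_bounded_above[of UNIV m D] 0 by simp
    then show ?case using 0 by simp
  next
    case (Suc r)
    show ?case
    proof (cases "\<exists>l. D \<le> m l + N")
      case True
      then have "pmonom \<tau> m * s \<in> ?R"
        unfolding boundary_monoms_def using Suc.prems by (intro set_times_intro) auto
      then show ?thesis
        using span_times[OF power_in_span_pmonoms[OF c(1), of "Suc r"] span_base] by blast
    next
      case False
      have step: "(c ^ r * (\<tau> l * pmonom \<tau> m)) * (h l * s) \<in> span (pmonoms \<zeta> (b * Suc r) * ?R)" for l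
      proof (rule span_mult_left[OF h[OF \<open>s \<in> S\<close>]])
        fix x assume "x \<in> pmonoms \<zeta> b * pmonoms \<tau> N * S"
        then obtain a m' s' where x: "x = a * pmonom \<tau> m' * s'" "a \<in> pmonoms \<zeta> b"
          "\<forall>l. m' l \<le> N" "s' \<in> S"
          by (auto simp: pmonoms_def elim!: set_times_elim)
        let ?m = "\<lambda>i. (m(l := m l + 1)) i + m' i"
        have "?m i \<le> D" for i
        proof -
          have "m i + N < D" "m' i \<le> N" using False x(3) by (auto simp: not_le)
          then show ?thesis by auto
        qed
        moreover have "sum (m(l := m l + 1)) UNIV = sum m UNIV + 1"
          by (simp add: sum.remove[of UNIV l])
        then have "CARD('l) * D + 1 \<le> sum ?m UNIV + r"
          using Suc.prems(3) by (simp add: sum.distrib)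
        ultimately have "c ^ r * (pmonom \<tau> ?m * s') \<in> span (pmonoms \<zeta> (b * r) * ?R)"
          using x(4) by (intro Suc.IH) auto
        from span_times[OF span_base[OF x(2)] this]
        have "a * (c ^ r * (pmonom \<tau> ?m * s')) \<in> span (pmonoms \<zeta> (b + b * r) * ?R)"
          unfolding mult.assoc[symmetric, of "pmonoms \<zeta> b"]
          using span_mono[OF set_times_mono2[OF pmonoms_times order_refl]] by blast
        moreover have "pmonom \<tau> ?m = \<tau> l * pmonom \<tau> m * pmonom \<tau> m'"
          using pmonom_upd[of \<tau> l 1 m] by (simp add: pmonom_add)
        ultimately show "(c ^ r * (\<tau> l * pmonom \<tau> m)) * x \<in> span (pmonoms \<zeta> (b * Suc r) * ?R)"
          by (simp add: x(1) ac_simps)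
      qed
      have "c ^ Suc r * (pmonom \<tau> m * s) = (\<Sum>l\<in>UNIV. (c ^ r * (\<tau> l * pmonom \<tau> m)) * (h l * s))"
        by (subst power_Suc, subst c(2)) (simp add: sum_distrib_right sum_distrib_left ac_simps)
      then show ?thesis by (simp only:) (intro span_sum step)
    qed
  qed
  show ?thesis using main[of m 1 "CARD('l) * D + 1"] S m by simp
qed

subsection \<open>Growth relative to a set of variables\<close>

definition growth_over ::
  "('z::finite \<Rightarrow> 'a::{comm_ring_1,real_algebra_1}) \<Rightarrow> nat \<Rightarrow> (nat \<Rightarrow> 'a set) \<Rightarrow> bool" where
  "growth_over \<zeta> r F \<longleftrightarrow> (\<exists>\<kappa> b. \<forall>D. \<exists>B. finite B \<and> card B \<le> \<kappa> * (D + 1) ^ r \<and>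
     F D \<subseteq> span (pmonoms \<zeta> (b * (D + 1)) * B))"

lemma growth_over_subset:
  assumes "growth_over \<zeta> r F" "\<And>D. F' D \<subseteq> F D"
  shows "growth_over \<zeta> r F'"
  using assms unfolding growth_over_def by (meson order_trans)

lemma growth_over_span:
  assumes "growth_over \<zeta> r F"
  shows "growth_over \<zeta> r (\<lambda>D. span (F D))"
  using assms unfolding growth_over_def by (meson span_minimal subspace_span)

lemma growth_over_times:
  assumes "growth_over \<zeta> r F" "growth_over \<zeta> s G"
  shows "growth_over \<zeta> (r + s) (\<lambda>D. F D * G D)"
proof -
  from assms obtain \<kappa> b \<kappa>' b' where
    F: "\<And>D. \<exists>B. finite B \<and> card B \<le> \<kappa> * (D + 1) ^ r \<and> F D \<subseteq> span (pmonoms \<zeta> (b * (D + 1)) * B)" and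
    G: "\<And>D. \<exists>B. finite B \<and> card B \<le> \<kappa>' * (D + 1) ^ s \<and> G D \<subseteq> span (pmonoms \<zeta> (b' * (D + 1)) * B)"
    unfolding growth_over_def by blast
  have "\<exists>B. finite B \<and> card B \<le> (\<kappa> * \<kappa>') * (D + 1) ^ (r + s) \<and>
      F D * G D \<subseteq> span (pmonoms \<zeta> ((b + b') * (D + 1)) * B)" for D
  proof -
    obtain B where B: "finite B" "card B \<le> \<kappa> * (D + 1) ^ r"
      "F D \<subseteq> span (pmonoms \<zeta> (b * (D + 1)) * B)" using F by blast
    obtain C where C: "finite C" "card C \<le> \<kappa>' * (D + 1) ^ s"
      "G D \<subseteq> span (pmonoms \<zeta> (b' * (D + 1)) * C)" using G by blast
    have "card (B * C) \<le> (\<kappa> * (D + 1) ^ r) * (\<kappa>' * (D + 1) ^ s)"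
      using finite_card_set_times(2)[OF B(1) C(1)] mult_mono[OF B(2) C(2)] by simp
    also have "\<dots> = (\<kappa> * \<kappa>') * (D + 1) ^ (r + s)"
      by (simp only: power_add ac_simps)
    finally have card: "card (B * C) \<le> (\<kappa> * \<kappa>') * (D + 1) ^ (r + s)" .
    have "F D * G D \<subseteq>
        span ((pmonoms \<zeta> (b * (D + 1)) * B) * (pmonoms \<zeta> (b' * (D + 1)) * C))"
      by (rule set_times_subset_span[OF B(3) C(3)])
    also have "(pmonoms \<zeta> (b * (D + 1)) * B) * (pmonoms \<zeta> (b' * (D + 1)) * C)
        = (pmonoms \<zeta> (b * (D + 1)) * pmonoms \<zeta> (b' * (D + 1))) * (B * C)"
      by (simp only: ac_simps)
    also have "span \<dots> \<subseteq> span (pmonoms \<zeta> ((b + b') * (D + 1)) * (B * C))"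
      unfolding add_mult_distrib by (intro span_mono set_times_mono2 pmonoms_times order_refl)
    finally have "F D * G D \<subseteq> span (pmonoms \<zeta> ((b + b') * (D + 1)) * (B * C))" .
    then show ?thesis
      using finite_card_set_times(1)[OF B(1) C(1)] card by blast
  qed
  then show ?thesis unfolding growth_over_def by blast
qed

lemma growth_over_pmonoms: "growth_over \<zeta> 0 (\<lambda>D. pmonoms \<zeta> (a * D))"
  unfolding growth_over_def
proof (intro exI allI conjI)
  fix D
  show "finite {1}" by simp
  show "card {1} \<le> 1 * (D + 1) ^ 0" by simp
  have "pmonoms \<zeta> (a * D) \<subseteq> pmonoms \<zeta> (a * (D + 1))"
    by (intro pmonoms_mono) simp
  then show "pmonoms \<zeta> (a * D) \<subseteq> span (pmonoms \<zeta> (a * (D + 1)) * {1})"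
    by (simp flip: set_one) (meson order_trans span_superset)
qed

lemma growth_over_prod:
  assumes "finite K" "\<And>k. k \<in> K \<Longrightarrow> growth_over \<zeta> r (F k)"
  shows "growth_over \<zeta> (r * card K) (\<lambda>D. \<Prod>k\<in>K. F k D)"
  using assms
proof (induction K rule: finite_induct)
  case empty
  have "growth_over \<zeta> 0 (\<lambda>D. 1)"
    by (rule growth_over_subset[OF growth_over_pmonoms[of \<zeta> 0]]) (auto simp: one_in_pmonoms)
  then show ?case by simp
next
  case (insert k K)
  then show ?case using growth_over_times[of \<zeta> r "F k" "r * card K"] by simp
qed

lemma growth_over_algebraic_point:
  fixes \<zeta> :: "'z::finite \<Rightarrow> 'a::{comm_ring_1,real_algebra_1}"
    and \<tau> :: "'l::finite \<Rightarrow> 'a" and \<sigma> :: "'j::finite \<Rightarrow> 'a"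
  assumes n: "n > 0" and \<rho>: "\<And>j. \<sigma> j ^ n \<in> polys (range \<zeta> \<union> range \<tau>)"
    and c: "c \<in> polys (range \<zeta>)" "c = (\<Sum>l\<in>UNIV. \<tau> l * h l)"
    and h: "\<And>l. h l \<in> polys (range \<zeta> \<union> range \<tau> \<union> range \<sigma>)"
  shows "growth_over \<zeta> (CARD('l) - 1) (\<lambda>D. {c ^ (CARD('l) * D + 1)} * pmonoms \<tau> D)"
proof -
  let ?S = "pmonoms \<sigma> (n - 1)"
  let ?V = "\<lambda>d. pmonoms \<zeta> d * pmonoms \<tau> d * ?S"
  obtain b where b: "c \<in> span (pmonoms \<zeta> b)"
    using polys_in_span_pmonoms[OF c(1)] ..
  have "\<exists>d. \<forall>(l, s) \<in> UNIV \<times> ?S. h l * s \<in> span (?V d)"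
  proof (rule finite_uniform_bound)
    show "finite ((UNIV::'l set) \<times> ?S)" by (simp add: finite_card_pmonoms)
    fix p assume p: "p \<in> (UNIV::'l set) \<times> ?S"
    obtain l s where ls: "p = (l, s)" by (cases p)
    then obtain e where e: "s = pmonom \<sigma> e" using p by (auto simp: pmonoms_def)
    have "h l * s \<in> polys (range \<zeta> \<union> range \<tau> \<union> range \<sigma>)"
      unfolding e pmonom_def by (intro polys.mult h polys_prod polys_power polys.gen) auto
    from polys_reduce_roots[OF this n \<rho>]
    show "\<exists>d. case p of (l, s) \<Rightarrow> h l * s \<in> span (?V d)" by (simp add: ls)
  next
    fix p d d' assume "case p of (l, s) \<Rightarrow> h l * s \<in> span (?V d)" "d \<le> (d' :: nat)"
    moreover have "?V d \<subseteq> ?V d'" 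
      using \<open>d \<le> d'\<close> by (intro set_times_mono2 pmonoms_mono order_refl)
    ultimately show "case p of (l, s) \<Rightarrow> h l * s \<in> span (?V d')"
      using span_mono by (cases p) blast
  qed
  then obtain N where N: "h l * s \<in> span (?V N)" if "s \<in> ?S" for l s by blast
  let ?b = "b + N"
  have sub: "pmonoms \<zeta> b \<subseteq> pmonoms \<zeta> ?b" "?V N \<subseteq> pmonoms \<zeta> ?b * pmonoms \<tau> N * ?S"
    by (rule pmonoms_mono, simp) (intro set_times_mono2 pmonoms_mono order_refl, simp)
  have push: "c ^ (CARD('l) * D + 1) * pmonom \<tau> m
      \<in> span (pmonoms \<zeta> (?b * (CARD('l) * D + 1)) * boundary_monoms \<tau> ?S N D)"
    if "\<And>l. m l \<le> D" for m D
  proof (rule push_to_boundary[OF one_in_pmonoms _ c(2) _ that])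
    show "c \<in> span (pmonoms \<zeta> ?b)" using b span_mono[OF sub(1)] by blast
    show "h l * s \<in> span (pmonoms \<zeta> ?b * pmonoms \<tau> N * ?S)" if "s \<in> ?S" for l s
      using N[OF that] span_mono[OF sub(2)] by blast
  qed
  have le: "?b * (CARD('l) * D + 1) \<le> (?b * CARD('l)) * (D + 1)" for D
    by simp
  show ?thesis
    unfolding growth_over_def
  proof (intro exI allI conjI)
    fix D
    show "finite (boundary_monoms \<tau> ?S N D)"
      by (intro finite_card_boundary_monoms finite_card_pmonoms)
    show "card (boundary_monoms \<tau> ?S N D)
        \<le> (CARD('l) * (N + 1) * card ?S) * (D + 1) ^ (CARD('l) - 1)"
      by (intro finite_card_boundary_monoms finite_card_pmonoms)
    show "{c ^ (CARD('l) * D + 1)} * pmonoms \<tau> D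
        \<subseteq> span (pmonoms \<zeta> (?b * CARD('l) * (D + 1)) * boundary_monoms \<tau> ?S N D)"
    proof
      fix x assume "x \<in> {c ^ (CARD('l) * D + 1)} * pmonoms \<tau> D"
      then obtain m where "x = c ^ (CARD('l) * D + 1) * pmonom \<tau> m" "\<forall>l. m l \<le> D"
        by (auto simp: pmonoms_def elim!: set_times_elim)
      then show "x \<in> span (pmonoms \<zeta> (?b * CARD('l) * (D + 1)) * boundary_monoms \<tau> ?S N D)"
        using push[of m D] span_mono[OF set_times_mono2[OF pmonoms_mono[OF le] order_refl]] by blast
    qed
  qed
qed

lemma growth_over_translate:
  fixes \<zeta> :: "'z::finite \<Rightarrow> 'a::{comm_ring_1,real_algebra_1}" and \<tau> :: "'l::finite \<Rightarrow> 'a"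
  assumes gr: "growth_over \<zeta> r (\<lambda>D. {a D} * pmonoms \<tau> D)"
    and t: "\<And>l. t l = \<zeta> (f l) + \<tau> l"
  shows "growth_over \<zeta> r (\<lambda>D. {a D} * pmonoms t D)"
proof -
  have pow: "t l ^ k \<in> span (pmonoms \<zeta> k * {\<tau> l ^ i | i. i \<le> k})" for l k
  proof (induction k)
    case 0
    have "1 * 1 \<in> pmonoms \<zeta> 0 * {\<tau> l ^ i | i. i \<le> 0}"
      by (intro set_times_intro one_in_pmonoms) auto
    then show ?case by (auto intro: span_base)
  next
    case (Suc k)
    have "t l * t l ^ k \<in> span (pmonoms \<zeta> (Suc k) * {\<tau> l ^ i | i. i \<le> Suc k})"
    proof (rule span_mult_left[OF Suc])
      fix x assume "x \<in> pmonoms \<zeta> k * {\<tau> l ^ i | i. i \<le> k}"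
      then obtain z i where x: "x = z * \<tau> l ^ i" "z \<in> pmonoms \<zeta> k" "i \<le> k"
        by (auto elim!: set_times_elim)
      have "\<zeta> (f l) * z \<in> pmonoms \<zeta> 1 * pmonoms \<zeta> k"
        using x(2) gen_in_pmonoms[of \<zeta> _ 0] by (intro set_times_intro) auto
      then have "(\<zeta> (f l) * z) * \<tau> l ^ i \<in> pmonoms \<zeta> (Suc k) * {\<tau> l ^ i | i. i \<le> Suc k}"
        using pmonoms_times[of \<zeta> 1 k] x(3) by (intro set_times_intro) auto
      moreover have "z * \<tau> l ^ Suc i \<in> pmonoms \<zeta> (Suc k) * {\<tau> l ^ i | i. i \<le> Suc k}"
        using x(2,3) pmonoms_mono[of k "Suc k" \<zeta>]
        by (intro set_times_intro) (auto intro!: exI[of _ "Suc i"])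
      ultimately have "(\<zeta> (f l) * z) * \<tau> l ^ i + z * \<tau> l ^ Suc i
          \<in> span (pmonoms \<zeta> (Suc k) * {\<tau> l ^ i | i. i \<le> Suc k})"
        by (intro span_add span_base)
      then show "t l * x \<in> span (pmonoms \<zeta> (Suc k) * {\<tau> l ^ i | i. i \<le> Suc k})"
        by (simp add: x(1) t algebra_simps)
    qed
    then show ?case by simp
  qed
  have mon: "pmonoms t D \<subseteq> span (pmonoms \<zeta> (CARD('l) * D) * pmonoms \<tau> D)" for D
  proof
    fix x assume "x \<in> pmonoms t D"
    then obtain e where e: "x = (\<Prod>l\<in>UNIV. t l ^ e l)" "\<And>l. e l \<le> D"
      by (auto simp: pmonoms_def pmonom_def)
    have "x \<in> span (\<Prod>l\<in>UNIV. pmonoms \<zeta> D * {\<tau> l ^ i | i. i \<le> D})"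
      unfolding e(1)
    proof (rule span_prod_mem)
      fix l
      have "pmonoms \<zeta> (e l) * {\<tau> l ^ i | i. i \<le> e l} \<subseteq> pmonoms \<zeta> D * {\<tau> l ^ i | i. i \<le> D}"
        using e(2)[of l] by (intro set_times_mono2 pmonoms_mono) (auto intro: order_trans)
      then show "t l ^ e l \<in> span (pmonoms \<zeta> D * {\<tau> l ^ i | i. i \<le> D})"
        using pow[of l "e l"] span_mono by blast
    qed
    moreover have "(\<Prod>l\<in>L. pmonoms \<zeta> D) \<subseteq> pmonoms \<zeta> (card L * D)" for L :: "'l set"
    proof (induction L rule: infinite_finite_induct)
      case (insert l L)
      then show ?case
        using set_times_mono2[OF order_refl[of "pmonoms \<zeta> D"] insert.IH]
          pmonoms_times[of \<zeta> D "card L * D"] by auto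
    qed (auto simp: one_in_pmonoms)
    moreover have "(\<Prod>l\<in>L. {\<tau> l ^ i | i. i \<le> D})
        \<subseteq> {\<Prod>l\<in>L. \<tau> l ^ e l | e. \<forall>l. e l \<le> D}" for L
    proof (induction L rule: infinite_finite_induct)
      case (insert l L)
      show ?case
      proof
        fix y assume "y \<in> (\<Prod>l\<in>insert l L. {\<tau> l ^ i | i. i \<le> D})"
        then have "y \<in> {\<tau> l ^ i | i. i \<le> D} * (\<Prod>l\<in>L. {\<tau> l ^ i | i. i \<le> D})"
          using insert by simp
        then obtain i e where y: "y = \<tau> l ^ i * (\<Prod>l\<in>L. \<tau> l ^ e l)" "i \<le> D" "\<forall>l. e l \<le> D"
          using insert.IH by (elim set_times_elim) blast
        have "(\<Prod>l\<in>L. \<tau> l ^ e l) = (\<Prod>k\<in>L. \<tau> k ^ (e(l := i)) k)"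
          using insert by (intro prod.cong) auto
        then have "y = (\<Prod>k\<in>insert l L. \<tau> k ^ (e(l := i)) k)"
          using insert y(1) by simp
        moreover have "\<forall>k. (e(l := i)) k \<le> D" using y by simp
        ultimately show "y \<in> {\<Prod>l\<in>insert l L. \<tau> l ^ e l | e. \<forall>l. e l \<le> D}"
          by blast
      qed
    qed auto
    then have "(\<Prod>l\<in>UNIV. {\<tau> l ^ i | i. i \<le> D}) \<subseteq> pmonoms \<tau> D"
      unfolding pmonoms_def pmonom_def .
    ultimately have "(\<Prod>l\<in>UNIV. pmonoms \<zeta> D * {\<tau> l ^ i | i. i \<le> D})
        \<subseteq> pmonoms \<zeta> (CARD('l) * D) * pmonoms \<tau> D"
      unfolding prod.distrib by (intro set_times_mono2) auto
    then show "x \<in> span (pmonoms \<zeta> (CARD('l) * D) * pmonoms \<tau> D)"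
      using \<open>x \<in> span _\<close> span_mono by blast
  qed
  have sub: "{a D} * pmonoms t D \<subseteq> span (pmonoms \<zeta> (CARD('l) * D) * ({a D} * pmonoms \<tau> D))" for D
  proof -
    have "{a D} * pmonoms t D \<subseteq> span ({a D} * (pmonoms \<zeta> (CARD('l) * D) * pmonoms \<tau> D))"
      by (intro set_times_subset_span mon) (auto intro: span_base)
    also have "{a D} * (pmonoms \<zeta> (CARD('l) * D) * pmonoms \<tau> D)
        = pmonoms \<zeta> (CARD('l) * D) * ({a D} * pmonoms \<tau> D)"
      by (rule mult.left_commute)
    finally show ?thesis .
  qed
  show ?thesis
    using growth_over_subset[OF growth_over_span[OF growth_over_times[OF growth_over_pmonoms gr]] sub]
    by simp
qed

lemma finite_card_bounded_exponents:
  "finite {e :: 'i::finite \<Rightarrow> nat. \<forall>i. e i \<le> D}"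
  "card {e :: 'i::finite \<Rightarrow> nat. \<forall>i. e i \<le> D} = (D + 1) ^ CARD('i)"
proof -
  have eq: "{e :: 'i \<Rightarrow> nat. \<forall>i. e i \<le> D} = PiE UNIV (\<lambda>_. {..D})"
    by (auto simp: PiE_def)
  show "finite {e :: 'i \<Rightarrow> nat. \<forall>i. e i \<le> D}"
    unfolding eq by (intro finite_PiE) auto
  show "card {e :: 'i \<Rightarrow> nat. \<forall>i. e i \<le> D} = (D + 1) ^ CARD('i)"
    unfolding eq by (simp add: card_PiE)
qed

lemma growth_over_imp_dependence:
  fixes \<zeta> :: "'z::finite \<Rightarrow> 'a::{comm_ring_1,real_algebra_1}" and g :: "'i::finite \<Rightarrow> 'a"
  assumes gr: "growth_over \<zeta> r F" and less: "CARD('z) + r < CARD('i)"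
    and mem: "\<And>D e. (\<And>i. e i \<le> D) \<Longrightarrow> a D * pmonom g e \<in> F D"
  shows "\<exists>D c. (\<exists>e\<in>{e. \<forall>i. e i \<le> D}. c e \<noteq> 0) \<and>
    (\<Sum>e\<in>{e. \<forall>i. e i \<le> D}. c e *\<^sub>R (a D * pmonom g e)) = 0"
proof -
  from gr obtain \<kappa> b where
    \<kappa>: "\<And>D. \<exists>B. finite B \<and> card B \<le> \<kappa> * (D + 1) ^ r \<and> F D \<subseteq> span (pmonoms \<zeta> (b * (D + 1)) * B)"
    unfolding growth_over_def by blast
  define D where "D = (b + 1) ^ CARD('z) * \<kappa>"
  obtain B where B: "finite B" "card B \<le> \<kappa> * (D + 1) ^ r"
    "F D \<subseteq> span (pmonoms \<zeta> (b * (D + 1)) * B)" using \<kappa> by blast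
  let ?T = "pmonoms \<zeta> (b * (D + 1)) * B" and ?E = "{e :: 'i \<Rightarrow> nat. \<forall>i. e i \<le> D}"
  have "card ?T \<le> card (pmonoms \<zeta> (b * (D + 1))) * card B"
    by (intro finite_card_set_times finite_card_pmonoms B)
  also have "\<dots> \<le> (b * (D + 1) + 1) ^ CARD('z) * (\<kappa> * (D + 1) ^ r)"
    by (intro mult_mono finite_card_pmonoms B) auto
  also have "\<dots> \<le> ((b + 1) * (D + 1)) ^ CARD('z) * (\<kappa> * (D + 1) ^ r)"
    by (intro mult_right_mono power_mono) auto
  also have "\<dots> = D * (D + 1) ^ (CARD('z) + r)"
    by (simp only: D_def power_mult_distrib power_add ac_simps)
  also have "\<dots> < (D + 1) * (D + 1) ^ (CARD('z) + r)"
    by (intro mult_strict_right_mono) auto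
  also have "\<dots> = (D + 1) ^ Suc (CARD('z) + r)" by simp
  also have "\<dots> \<le> (D + 1) ^ CARD('i)"
    using less by (intro power_increasing) auto
  also have "\<dots> = card ?E" by (simp add: finite_card_bounded_exponents)
  finally have card: "card ?T < card ?E" .
  show ?thesis
  proof (rule dependent_family[of ?E ?T "\<lambda>e. a D * pmonom g e"])
    show "finite ?E" by (rule finite_card_bounded_exponents)
    show "finite ?T" by (intro finite_card_set_times finite_card_pmonoms B)
    show "a D * pmonom g e \<in> span ?T" if "e \<in> ?E" for e
      using mem[of e D] B(3) that by blast
    show "card ?T < card ?E" by (rule card)
  qed blast
qed

definition lin_ideal :: "'a::{comm_ring_1,real_algebra_1} set \<Rightarrow> ('l::finite \<Rightarrow> 'a) \<Rightarrow> 'a set" where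
  "lin_ideal G \<tau> = {\<Sum>l\<in>UNIV. \<tau> l * h l | h. \<forall>l. h l \<in> polys G}"

lemma lin_idealI:
  "(\<And>l. h l \<in> polys G) \<Longrightarrow> f = (\<Sum>l\<in>UNIV. \<tau> l * h l) \<Longrightarrow> f \<in> lin_ideal G \<tau>"
  unfolding lin_ideal_def by blast

lemma lin_ideal_0: "0 \<in> lin_ideal G \<tau>"
  by (rule lin_idealI[of "\<lambda>_. 0"]) (auto intro: polys_0)

lemma lin_ideal_add:
  assumes "f \<in> lin_ideal G \<tau>" "g \<in> lin_ideal G \<tau>"
  shows "f + g \<in> lin_ideal G \<tau>"
proof -
  obtain h k where "\<forall>l. h l \<in> polys G" "\<forall>l. k l \<in> polys G"
    "f = (\<Sum>l\<in>UNIV. \<tau> l * h l)" "g = (\<Sum>l\<in>UNIV. \<tau> l * k l)"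
    using assms unfolding lin_ideal_def by blast
  then show ?thesis
    by (intro lin_idealI[of "\<lambda>l. h l + k l"]) (auto intro: polys.add simp: distrib_left sum.distrib)
qed

lemma lin_ideal_mult:
  assumes "f \<in> lin_ideal G \<tau>" "g \<in> polys G"
  shows "f * g \<in> lin_ideal G \<tau>"
proof -
  obtain h where "\<forall>l. h l \<in> polys G" "f = (\<Sum>l\<in>UNIV. \<tau> l * h l)"
    using assms unfolding lin_ideal_def by blast
  then show ?thesis
    using assms(2)
    by (intro lin_idealI[of "\<lambda>l. h l * g"]) (auto intro: polys.mult simp: sum_distrib_left ac_simps)
qed

lemma lin_ideal_diff_prod:
  assumes "\<And>i. i \<in> I \<Longrightarrow> f i \<in> polys G" "\<And>i. i \<in> I \<Longrightarrow> g i \<in> polys G"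
    "\<And>i. i \<in> I \<Longrightarrow> f i - g i \<in> lin_ideal G \<tau>"
  shows "(\<Prod>i\<in>I. f i) - (\<Prod>i\<in>I. g i) \<in> lin_ideal G \<tau>"
  using assms
proof (induction I rule: infinite_finite_induct)
  case (insert i I)
  have "(\<Prod>i\<in>insert i I. f i) - (\<Prod>i\<in>insert i I. g i)
      = (f i - g i) * (\<Prod>i\<in>I. f i) + ((\<Prod>i\<in>I. f i) - (\<Prod>i\<in>I. g i)) * g i"
    using insert by (simp add: algebra_simps)
  then show ?case
    using insert by (auto intro!: lin_ideal_add lin_ideal_mult polys_prod)
qed (auto intro: lin_ideal_0)

text \<open>Here \<open>\<sigma> j ^ n\<close> is the \<open>2p\<close>-th power of the distance between the points \<open>j\<close> and \<open>t = z\<^sub>0 + \<tau>\<close>,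
  and \<open>rel\<close> is the equation \<open>\<Sum>j. \<epsilon> j / \<sigma> j = 0\<close> solved for \<open>1 / \<sigma> j\<^sub>0\<close> and cleared of denominators;
  modulo \<open>\<tau>\<close> its right-hand side vanishes, while its left-hand side becomes independent of \<open>t\<close>.\<close>

lemma separation_in_lin_ideal:
  fixes \<zeta> :: "'j::finite \<times> 'l::finite \<Rightarrow> 'a::{comm_ring_1,real_algebra_1}"
    and \<tau> :: "'l \<Rightarrow> 'a" and \<sigma> :: "'j \<Rightarrow> 'a"
  assumes p: "p > 0"
    and root: "\<And>j. \<sigma> j ^ n = (\<Sum>l\<in>UNIV. (\<zeta> (j, l) - \<zeta> (j0, l) - \<tau> l)\<^sup>2) ^ p"
    and rel: "(\<Prod>j\<in>-{j0}. \<sigma> j) = \<sigma> j0 * H"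
    and H: "H \<in> polys (range \<sigma>)"
  shows "(\<Prod>j\<in>-{j0}. (\<Sum>l\<in>UNIV. (\<zeta> (j, l) - \<zeta> (j0, l))\<^sup>2) ^ p)
    \<in> lin_ideal (range \<zeta> \<union> range \<tau> \<union> range \<sigma>) \<tau>"
proof -
  let ?G = "range \<zeta> \<union> range \<tau> \<union> range \<sigma>"
  define q0 where "q0 j = (\<Sum>l\<in>UNIV. (\<zeta> (j, l) - \<zeta> (j0, l))\<^sup>2)" for j
  define q where "q j = (\<Sum>l\<in>UNIV. (\<zeta> (j, l) - \<zeta> (j0, l) - \<tau> l)\<^sup>2)" for j
  have gen: "\<zeta> x \<in> polys ?G" "\<tau> l \<in> polys ?G" for x l
    by (auto intro: polys.gen)
  have pol: "q0 j \<in> polys ?G" "q j \<in> polys ?G" for j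
    unfolding q0_def q_def by (intro polys_sum polys_power polys_diff gen)+
  have H': "H \<in> polys ?G" using H by (rule polys_mono[rotated]) auto
  have diff: "q0 j - q j \<in> lin_ideal ?G \<tau>" for j
  proof (rule lin_idealI)
    show "(\<zeta> (j, l) - \<zeta> (j0, l)) + (\<zeta> (j, l) - \<zeta> (j0, l)) - \<tau> l \<in> polys ?G" for l
      by (intro polys_diff polys.add gen)
    show "q0 j - q j = (\<Sum>l\<in>UNIV. \<tau> l * ((\<zeta> (j, l) - \<zeta> (j0, l)) + (\<zeta> (j, l) - \<zeta> (j0, l)) - \<tau> l))"
      unfolding q0_def q_def sum_subtractf[symmetric]
      by (intro sum.cong) (auto simp: power2_eq_square algebra_simps)
  qed
  have powdiff: "q0 j ^ p - q j ^ p \<in> lin_ideal ?G \<tau>" for j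
    using lin_ideal_diff_prod[of "{..<p}" "\<lambda>_. q0 j" ?G "\<lambda>_. q j" \<tau>] pol diff by simp
  have d: "(\<Prod>j\<in>-{j0}. q0 j ^ p) - (\<Prod>j\<in>-{j0}. q j ^ p) \<in> lin_ideal ?G \<tau>"
    by (intro lin_ideal_diff_prod polys_power pol powdiff)
  have "q j0 \<in> lin_ideal ?G \<tau>"
    by (rule lin_idealI[of \<tau>]) (auto simp: gen q_def power2_eq_square)
  moreover have "q j0 ^ p = q j0 * q j0 ^ (p - 1)"
    using p by (metis Suc_diff_1 power_Suc)
  ultimately have "q j0 ^ p * H ^ n \<in> lin_ideal ?G \<tau>"
    by (simp add: lin_ideal_mult polys_power pol H')
  moreover have "(\<Prod>j\<in>-{j0}. q j ^ p) = (\<Prod>j\<in>-{j0}. \<sigma> j) ^ n"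
    using root by (simp add: prod_power_distrib flip: q_def)
  then have "(\<Prod>j\<in>-{j0}. q j ^ p) = q j0 ^ p * H ^ n"
    by (simp only: rel power_mult_distrib root[of j0, folded q_def])
  ultimately have "(\<Prod>j\<in>-{j0}. q j ^ p) \<in> lin_ideal ?G \<tau>" by simp
  from lin_ideal_add[OF d this] show ?thesis unfolding q0_def by simp
qed

subsection \<open>Dependence of functions on the incidence set\<close>

instantiation "fun" :: (type, scaleR) scaleR
begin

definition "scaleR_fun r f = (\<lambda>x. r *\<^sub>R f x)"

instance ..

end

lemma scaleR_fun_apply [simp]: "(r *\<^sub>R f) x = r *\<^sub>R f x"
  by (simp add: scaleR_fun_def)

instance "fun" :: (type, real_vector) real_vector
  by standard (auto simp: fun_eq_iff scaleR_add_right scaleR_add_left)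

instance "fun" :: (type, real_algebra) real_algebra
  by standard (auto simp: fun_eq_iff)

instance "fun" :: (type, real_algebra_1) real_algebra_1 ..

lemma of_real_fun_apply [simp]: "(of_real r :: 'a \<Rightarrow> 'b::real_algebra_1) x = of_real r"
  by (simp add: of_real_def)

lemma power_fun_apply [simp]: "((f :: 'a \<Rightarrow> 'b::monoid_mult) ^ n) x = f x ^ n"
  by (induction n) auto

lemma sum_fun_apply [simp]: "(\<Sum>i\<in>I. (f i :: 'a \<Rightarrow> 'b::comm_monoid_add)) x = (\<Sum>i\<in>I. f i x)"
  by (induction I rule: infinite_finite_induct) auto

lemma prod_fun_apply [simp]: "(\<Prod>i\<in>I. (f i :: 'a \<Rightarrow> 'b::comm_monoid_mult)) x = (\<Prod>i\<in>I. f i x)"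
  by (induction I rule: infinite_finite_induct) auto

lemma set_prod_mem:
  fixes F :: "'k \<Rightarrow> 'a::comm_monoid_mult set"
  assumes "\<And>k. k \<in> K \<Longrightarrow> f k \<in> F k"
  shows "(\<Prod>k\<in>K. f k) \<in> (\<Prod>k\<in>K. F k)"
  using assms by (induction K rule: infinite_finite_induct) (auto intro: set_times_intro)

lemma clear_denominators:
  fixes \<epsilon> \<sigma> :: "'j::finite \<Rightarrow> real"
  assumes "(\<Sum>j\<in>UNIV. \<epsilon> j / \<sigma> j) = 0" "\<And>j. \<sigma> j \<noteq> 0" "\<epsilon> j0 \<noteq> 0"
  shows "(\<Prod>j\<in>-{j0}. \<sigma> j) = \<sigma> j0 * (- (1 / \<epsilon> j0) * (\<Sum>j\<in>-{j0}. \<epsilon> j * (\<Prod>i\<in>-{j0}-{j}. \<sigma> i)))"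
proof -
  let ?P = "\<Prod>j\<in>-{j0}. \<sigma> j"
  have "\<epsilon> j0 / \<sigma> j0 = - (\<Sum>j\<in>-{j0}. \<epsilon> j / \<sigma> j)"
    using assms(1) by (simp add: sum.remove[of UNIV j0] Compl_eq_Diff_UNIV)
  then have "\<epsilon> j0 / \<sigma> j0 * ?P = - (\<Sum>j\<in>-{j0}. \<epsilon> j / \<sigma> j * ?P)"
    by (simp add: sum_distrib_right)
  also have "(\<Sum>j\<in>-{j0}. \<epsilon> j / \<sigma> j * ?P) = (\<Sum>j\<in>-{j0}. \<epsilon> j * (\<Prod>i\<in>-{j0}-{j}. \<sigma> i))"
    using assms(2) by (intro sum.cong refl) (subst prod.remove, auto)
  finally show ?thesis
    using assms(2)[of j0] assms(3) by (simp add: field_simps)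
qed

lemma dependence_on_separated_piece:
  fixes z :: "'j::finite \<Rightarrow> 'w \<Rightarrow> real^'l" and t :: "'k \<Rightarrow> 'w \<Rightarrow> real^'l"
    and g :: "'i::finite \<Rightarrow> 'w \<Rightarrow> real"
  assumes \<alpha>: "\<alpha> = - (real p / real q)" "p > 0" "q > 0" and K: "finite K"
    and sep: "\<And>j w. j \<noteq> j0 \<Longrightarrow> z j w \<noteq> z j0 w"
    and ne: "\<And>j k w. k \<in> K \<Longrightarrow> z j w \<noteq> t k w"
    and \<epsilon>: "\<epsilon> j0 \<noteq> 0"
    and eqn: "\<And>k w. k \<in> K \<Longrightarrow> (\<Sum>j\<in>UNIV. \<epsilon> j * norm (z j w - t k w) powr \<alpha>) = 0"
    and card: "CARD('j \<times> 'l) + (CARD('l) - 1) * card K < CARD('i)"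
    and g: "\<And>D e. (\<And>i. e i \<le> D) \<Longrightarrow>
      pmonom g e \<in> pmonoms (\<lambda>(j, l) w. z j w $ l) D * (\<Prod>k\<in>K. pmonoms (\<lambda>l w. t k w $ l) D)"
  shows "\<exists>D c. (\<exists>e\<in>{e. \<forall>i. e i \<le> D}. c e \<noteq> 0) \<and>
    (\<forall>w. (\<Sum>e\<in>{e. \<forall>i. e i \<le> D}. c e * (\<Prod>i\<in>UNIV. g i w ^ e i)) = 0)"
proof -
  define \<zeta> :: "'j \<times> 'l \<Rightarrow> 'w \<Rightarrow> real" where "\<zeta> = (\<lambda>(j, l) w. z j w $ l)"
  define \<tau> :: "'k \<Rightarrow> 'l \<Rightarrow> 'w \<Rightarrow> real" where "\<tau> k l = (\<lambda>w. t k w $ l - z j0 w $ l)" for k l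
  define \<sigma> :: "'k \<Rightarrow> 'j \<Rightarrow> 'w \<Rightarrow> real"
    where "\<sigma> k j = (\<lambda>w. norm (z j w - t k w) powr (real p / real q))" for k j
  define c :: "'w \<Rightarrow> real" where "c = (\<Prod>j\<in>-{j0}. (\<Sum>l\<in>UNIV. (\<zeta> (j, l) - \<zeta> (j0, l))\<^sup>2) ^ p)"
  have norm2: "(norm v)\<^sup>2 = (\<Sum>l\<in>UNIV. (v $ l)\<^sup>2)" for v :: "real^'l"
    by (simp add: norm_vec_def L2_set_def sum_nonneg)
  have c_nz: "c w \<noteq> 0" for w
  proof -
    have "c w = (\<Prod>j\<in>-{j0}. ((norm (z j w - z j0 w))\<^sup>2) ^ p)"
      by (simp add: c_def norm2 \<zeta>_def)
    then show ?thesis using sep by auto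
  qed
  have root: "\<sigma> k j ^ (2 * q) = (\<Sum>l\<in>UNIV. (\<zeta> (j, l) - \<zeta> (j0, l) - \<tau> k l)\<^sup>2) ^ p"
    if "k \<in> K" for k j
  proof
    fix w
    have pos: "norm (z j w - t k w) > 0" using ne[OF that] by simp
    have "(\<sigma> k j ^ (2 * q)) w = norm (z j w - t k w) powr (real p / real q * real (2 * q))"
      using pos by (simp add: \<sigma>_def powr_powr flip: powr_realpow)
    also have "real p / real q * real (2 * q) = real (2 * p)"
      using \<alpha> by simp
    also have "norm (z j w - t k w) powr real (2 * p) = ((norm (z j w - t k w))\<^sup>2) ^ p"
      using pos by (simp only: powr_realpow power_mult)
    finally show "(\<sigma> k j ^ (2 * q)) w = ((\<Sum>l\<in>UNIV. (\<zeta> (j, l) - \<zeta> (j0, l) - \<tau> k l)\<^sup>2) ^ p) w"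
      by (simp add: norm2 \<zeta>_def \<tau>_def)
  qed
  have growth: "growth_over \<zeta> (CARD('l) - 1)
      (\<lambda>D. {c ^ (CARD('l) * D + 1)} * pmonoms (\<lambda>l w. t k w $ l) D)" if "k \<in> K" for k
  proof -
    define H where "H = of_real (- (1 / \<epsilon> j0)) *
      (\<Sum>j\<in>-{j0}. of_real (\<epsilon> j) * (\<Prod>i\<in>-{j0}-{j}. \<sigma> k i))"
    have rel: "(\<Prod>j\<in>-{j0}. \<sigma> k j) = \<sigma> k j0 * H"
    proof
      fix w
      have "\<sigma> k j w \<noteq> 0" for j using ne[OF that, of j w] by (simp add: \<sigma>_def)
      moreover have "(\<Sum>j\<in>UNIV. \<epsilon> j / \<sigma> k j w) = 0"
        using eqn[OF that, of w] by (simp add: \<sigma>_def \<alpha>(1) powr_minus_divide)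
      ultimately show "(\<Prod>j\<in>-{j0}. \<sigma> k j) w = (\<sigma> k j0 * H) w"
        using clear_denominators[of \<epsilon> "\<lambda>j. \<sigma> k j w" j0] \<epsilon> by (simp add: H_def)
    qed
    have "H \<in> polys (range (\<sigma> k))"
      unfolding H_def by (intro polys.mult polys.const polys_sum polys_prod polys.gen rangeI)
    from separation_in_lin_ideal[OF \<alpha>(2) root[OF that] rel this]
    obtain h where h: "\<And>l. h l \<in> polys (range \<zeta> \<union> range (\<tau> k) \<union> range (\<sigma> k))"
      "c = (\<Sum>l\<in>UNIV. \<tau> k l * h l)"
      unfolding c_def lin_ideal_def by blast
    have "c \<in> polys (range \<zeta>)"
      unfolding c_def by (intro polys_prod polys_power polys_sum polys_diff polys.gen rangeI)
    moreover have "\<sigma> k j ^ (2 * q) \<in> polys (range \<zeta> \<union> range (\<tau> k))" for j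
      unfolding root[OF that] by (intro polys_power polys_sum polys_diff polys.gen) auto
    ultimately have "growth_over \<zeta> (CARD('l) - 1) (\<lambda>D. {c ^ (CARD('l) * D + 1)} * pmonoms (\<tau> k) D)"
      using h \<alpha>(3) by (intro growth_over_algebraic_point[where n = "2 * q"]) auto
    then show ?thesis
      by (rule growth_over_translate[where f = "\<lambda>l. (j0, l)"]) (auto simp: \<zeta>_def \<tau>_def fun_eq_iff)
  qed
  define F where "F D = pmonoms \<zeta> (1 * D) *
      (\<Prod>k\<in>K. {c ^ (CARD('l) * D + 1)} * pmonoms (\<lambda>l w. t k w $ l) D)" for D
  have "growth_over \<zeta> (0 + (CARD('l) - 1) * card K) F"
    unfolding F_def by (intro growth_over_times growth_over_pmonoms growth_over_prod K growth)
  then have gr: "growth_over \<zeta> ((CARD('l) - 1) * card K) F" by simp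
  have mem: "(c ^ (CARD('l) * D + 1)) ^ card K * pmonom g e \<in> F D" if e: "\<And>i. e i \<le> D" for D e
  proof -
    obtain x y where xy: "pmonom g e = x * y" "x \<in> pmonoms \<zeta> D"
      "y \<in> (\<Prod>k\<in>K. pmonoms (\<lambda>l w. t k w $ l) D)"
      using g[of e D, OF e] unfolding \<zeta>_def by (elim set_times_elim) blast
    have "(\<Prod>k\<in>K. c ^ (CARD('l) * D + 1)) \<in> (\<Prod>k\<in>K. {c ^ (CARD('l) * D + 1)})"
      by (rule set_prod_mem) simp
    then have "x * ((\<Prod>k\<in>K. c ^ (CARD('l) * D + 1)) * y) \<in> F D"
      unfolding F_def prod.distrib using xy by (intro set_times_intro) auto
    then show ?thesis by (simp only: xy(1) prod_constant mult.left_commute)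
  qed
  from growth_over_imp_dependence[OF gr card mem]
  obtain D d where nz: "\<exists>e\<in>{e. \<forall>i. e i \<le> D}. d e \<noteq> 0" and
    sum: "(\<Sum>e\<in>{e. \<forall>i. e i \<le> D}. d e *\<^sub>R ((c ^ (CARD('l) * D + 1)) ^ card K * pmonom g e)) = 0"
    by blast
  have "(\<Sum>e\<in>{e. \<forall>i. e i \<le> D}. d e * (\<Prod>i\<in>UNIV. g i w ^ e i)) = 0" for w
  proof -
    have "(c w ^ (CARD('l) * D + 1)) ^ card K * (\<Sum>e\<in>{e. \<forall>i. e i \<le> D}. d e * (\<Prod>i\<in>UNIV. g i w ^ e i)) = 0"
      using fun_cong[OF sum, of w]
      by (simp add: pmonom_def sum_distrib_left mult.left_commute)
    then show ?thesis using c_nz[of w] by simp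
  qed
  with nz show ?thesis by blast
qed

subsection \<open>Elimination\<close>

lemma real_monomials_independent:
  fixes c :: "('i \<Rightarrow> nat) \<Rightarrow> real"
  assumes "finite J" "finite E"
    and "\<And>e e'. e \<in> E \<Longrightarrow> e' \<in> E \<Longrightarrow> (\<And>i. i \<in> J \<Longrightarrow> e i = e' i) \<Longrightarrow> e = e'"
    and "\<And>X. (\<Sum>e\<in>E. c e * (\<Prod>i\<in>J. X i ^ e i)) = 0"
    and "e \<in> E"
  shows "c e = 0"
  using assms
proof (induction J arbitrary: E e rule: finite_induct)
  case empty
  then have "E = {e}" by auto
  then show ?case using empty.prems(3) by simp
next
  case (insert a J)
  define N where "N = Max ((\<lambda>e. e a) ` E)"
  have N: "e' a \<le> N" if "e' \<in> E" for e'
    using insert.prems(1) that by (simp add: N_def)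
  define E' where "E' d = {e' \<in> E. e' a = d}" for d
  have coeff: "(\<Sum>e'\<in>E' d. c e' * (\<Prod>i\<in>J. X i ^ e' i)) = 0" if "d \<le> N" for d X
  proof -
    have "(\<Sum>d\<le>N. (\<Sum>e'\<in>E' d. c e' * (\<Prod>i\<in>J. X i ^ e' i)) * s ^ d) = 0" for s
    proof -
      have "(\<Sum>d\<le>N. (\<Sum>e'\<in>E' d. c e' * (\<Prod>i\<in>J. X i ^ e' i)) * s ^ d)
          = (\<Sum>d\<le>N. \<Sum>e'\<in>E' d. c e' * (\<Prod>i\<in>insert a J. (X(a := s)) i ^ e' i))"
        unfolding sum_distrib_right
      proof (intro sum.cong refl)
        fix d e' assume "e' \<in> E' d"
        moreover have "(\<Prod>i\<in>J. (X(a := s)) i ^ e' i) = (\<Prod>i\<in>J. X i ^ e' i)"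
          using insert.hyps by (intro prod.cong) auto
        ultimately show "c e' * (\<Prod>i\<in>J. X i ^ e' i) * s ^ d
            = c e' * (\<Prod>i\<in>insert a J. (X(a := s)) i ^ e' i)"
          using insert.hyps by (simp add: E'_def)
      qed
      also have "\<dots> = (\<Sum>e'\<in>E. c e' * (\<Prod>i\<in>insert a J. (X(a := s)) i ^ e' i))"
        unfolding E'_def using insert.prems(1) N by (intro sum.group) auto
      finally show ?thesis using insert.prems(3) by simp
    qed
    then show ?thesis
      using polyfun_eq_0[of "\<lambda>d. \<Sum>e'\<in>E' d. c e' * (\<Prod>i\<in>J. X i ^ e' i)" N] that by blast
  qed
  show ?case
  proof (rule insert.IH[of "E' (e a)"])
    show "finite (E' (e a))" using insert.prems(1) by (simp add: E'_def)
    show "e \<in> E' (e a)" using insert.prems(4) by (simp add: E'_def)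
    show "(\<Sum>e'\<in>E' (e a). c e' * (\<Prod>i\<in>J. X i ^ e' i)) = 0" for X
      using coeff N insert.prems(4) by simp
    show "f = f'" if "f \<in> E' (e a)" "f' \<in> E' (e a)" "\<And>i. i \<in> J \<Longrightarrow> f i = f' i" for f f'
    proof (rule insert.prems(2))
      show "f \<in> E" "f' \<in> E" using that by (auto simp: E'_def)
      show "f i = f' i" if "i \<in> insert a J" for i
        using that \<open>f \<in> E' (e a)\<close> \<open>f' \<in> E' (e a)\<close> \<open>\<And>i. i \<in> J \<Longrightarrow> f i = f' i\<close> by (auto simp: E'_def)
    qed
  qed
qed

lemma eliminate_variable:
  fixes c :: "('i::finite option \<Rightarrow> nat) \<Rightarrow> real"
  assumes E: "finite E" and e0: "e0 \<in> E" "c e0 \<noteq> 0"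
  shows "\<exists>d. (\<exists>X :: 'i \<Rightarrow> real. (\<Sum>e\<in>{e\<in>E. e None = d}. c e * (\<Prod>i\<in>UNIV. X i ^ e (Some i))) \<noteq> 0) \<and>
    (\<forall>X :: 'i \<Rightarrow> real. (\<Sum>e\<in>{e\<in>E. e None = d}. c e * (\<Prod>i\<in>UNIV. X i ^ e (Some i))) \<noteq> 0 \<longrightarrow>
      finite {s. (\<Sum>e\<in>E. c e * (s ^ e None * (\<Prod>i\<in>UNIV. X i ^ e (Some i)))) = 0})"
proof -
  let ?P = "\<lambda>d X. (\<Sum>e\<in>{e\<in>E. e None = d}. c e * (\<Prod>i\<in>UNIV. X i ^ e (Some i)))"
  define d where "d = e0 None"
  define ext :: "('i \<Rightarrow> nat) \<Rightarrow> 'i option \<Rightarrow> nat" where "ext f = case_option d f" for f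
  define E' where "E' = (\<lambda>e i. e (Some i)) ` {e\<in>E. e None = d}"
  have ext: "ext (\<lambda>i. e (Some i)) = e" if "e None = d" for e
    using that by (auto simp: ext_def fun_eq_iff split: option.split)
  have inj: "inj_on (\<lambda>e i. e (Some i)) {e\<in>E. e None = d}"
    by (rule inj_on_inverseI[of _ ext]) (simp add: ext)
  have sumE': "?P d X = (\<Sum>f\<in>E'. c (ext f) * (\<Prod>i\<in>UNIV. X i ^ f i))" for X :: "'i \<Rightarrow> real"
    unfolding E'_def by (subst sum.reindex[OF inj]) (auto intro!: sum.cong simp: ext)
  have ex: "\<exists>X. ?P d X \<noteq> 0"
  proof (rule ccontr)
    assume "\<not> ?thesis"
    then have "(\<Sum>f\<in>E'. c (ext f) * (\<Prod>i\<in>UNIV. X i ^ f i)) = 0" for X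
      by (simp only: sumE'[symmetric] not_ex not_not)
    moreover have "finite E'" "(\<lambda>i. e0 (Some i)) \<in> E'"
      using E e0(1) by (auto simp: E'_def d_def)
    ultimately have "c (ext (\<lambda>i. e0 (Some i))) = 0"
      by (intro real_monomials_independent[of UNIV E' "\<lambda>f. c (ext f)"]) auto
    then show False using e0(2) ext[of e0] by (simp add: d_def)
  qed
  define N where "N = Max ((\<lambda>e. e None) ` E)"
  have N: "e None \<le> N" if "e \<in> E" for e
    using E that by (simp add: N_def)
  have eq: "(\<Sum>e\<in>E. c e * (s ^ e None * (\<Prod>i\<in>UNIV. X i ^ e (Some i)))) = (\<Sum>d\<le>N. ?P d X * s ^ d)"
    for s and X :: "'i \<Rightarrow> real"
  proof -
    have "(\<Sum>d\<le>N. ?P d X * s ^ d)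
        = (\<Sum>d\<le>N. \<Sum>e\<in>{e\<in>E. e None = d}. c e * (s ^ e None * (\<Prod>i\<in>UNIV. X i ^ e (Some i))))"
      unfolding sum_distrib_right by (intro sum.cong refl) auto
    also have "\<dots> = (\<Sum>e\<in>E. c e * (s ^ e None * (\<Prod>i\<in>UNIV. X i ^ e (Some i))))"
      using E N by (intro sum.group) auto
    finally show ?thesis by simp
  qed
  have "d \<le> N" using N[OF e0(1)] by (simp add: d_def)
  then have "finite {s. (\<Sum>e\<in>E. c e * (s ^ e None * (\<Prod>i\<in>UNIV. X i ^ e (Some i)))) = 0}"
    if "?P d X \<noteq> 0" for X :: "'i \<Rightarrow> real"
    unfolding eq using polyfun_finite_roots[of "\<lambda>d. ?P d X" N] that by blast
  with ex show ?thesis by (intro exI[of _ d]) simp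
qed

lemma polyfun_sum: "(\<And>i. i \<in> I \<Longrightarrow> f i \<in> polyfun) \<Longrightarrow> (\<lambda>v. \<Sum>i\<in>I. f i v) \<in> polyfun"
  by (induction I rule: infinite_finite_induct) (auto intro: polyfun.const polyfun.add)

lemma polyfun_prod: "(\<And>i. i \<in> I \<Longrightarrow> f i \<in> polyfun) \<Longrightarrow> (\<lambda>v. \<Prod>i\<in>I. f i v) \<in> polyfun"
  by (induction I rule: infinite_finite_induct) (auto intro: polyfun.const polyfun.mult)

lemma polyfun_power: "f \<in> polyfun \<Longrightarrow> (\<lambda>v. f v ^ n) \<in> polyfun"
  by (induction n) (auto intro: polyfun.const polyfun.mult)

lemma UNIV_8: "(UNIV :: 8 set) = {1, 2, 3, 4, 5, 6, 7, 8}"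
  by (rule card_subset_eq[symmetric]) simp_all

subsection \<open>Generic properties\<close>

lemma polyfun_on_line:
  fixes P :: "real^'m^'n \<Rightarrow> real"
  assumes "P \<in> polyfun"
  shows "\<exists>p. \<forall>s. P (a + s *\<^sub>R b) = poly p s"
  using assms
proof induction
  case (const c)
  show ?case by (rule exI[of _ "[:c:]"]) simp
next
  case (coord j i)
  show ?case by (rule exI[of _ "[:a $ j $ i, b $ j $ i:]"]) simp
next
  case (add p q)
  then show ?case by (metis poly_add)
next
  case (mult p q)
  then show ?case by (metis poly_mult)
qed

definition generically :: "(real^'m^'n \<Rightarrow> bool) \<Rightarrow> bool" where
  "generically Q \<longleftrightarrow> (\<exists>P\<in>polyfun. (\<exists>v. P v \<noteq> 0) \<and> (\<forall>v. P v \<noteq> 0 \<longrightarrow> Q v))"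

lemma generically_mono: "generically Q \<Longrightarrow> (\<And>v. Q v \<Longrightarrow> R v) \<Longrightarrow> generically R"
  unfolding generically_def by blast

lemma generically_True: "generically (\<lambda>_. True)"
  unfolding generically_def by (rule bexI[OF _ polyfun.const[of 1]]) simp

lemma generically_conj:
  assumes "generically Q" "generically R"
  shows "generically (\<lambda>v. Q v \<and> R v)"
proof -
  from assms(1) obtain P1 v1 where 1: "P1 \<in> polyfun" "P1 v1 \<noteq> 0" "\<forall>v. P1 v \<noteq> 0 \<longrightarrow> Q v"
    unfolding generically_def by blast
  from assms(2) obtain P2 v2 where 2: "P2 \<in> polyfun" "P2 v2 \<noteq> 0" "\<forall>v. P2 v \<noteq> 0 \<longrightarrow> R v"
    unfolding generically_def by blast
  obtain p1 p2 where p1: "\<forall>s. P1 (v1 + s *\<^sub>R (v2 - v1)) = poly p1 s"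
    and p2: "\<forall>s. P2 (v1 + s *\<^sub>R (v2 - v1)) = poly p2 s"
    using polyfun_on_line 1(1) 2(1) by metis
  have "p1 \<noteq> 0" using spec[OF p1, of 0] 1(2) by auto
  moreover have "p2 \<noteq> 0" using spec[OF p2, of 1] 2(2) by auto
  ultimately obtain s where "poly (p1 * p2) s \<noteq> 0"
    using poly_all_0_iff_0[of "p1 * p2"] by auto
  then have "P1 (v1 + s *\<^sub>R (v2 - v1)) * P2 (v1 + s *\<^sub>R (v2 - v1)) \<noteq> 0"
    using p1 p2 by simp
  then show ?thesis
    unfolding generically_def using polyfun.mult[OF 1(1) 2(1)] 1(3) 2(3)
    by (intro bexI[of _ "\<lambda>v. P1 v * P2 v"]) auto
qed

lemma generically_ball:
  assumes "finite A" "\<And>a. a \<in> A \<Longrightarrow> generically (Q a)"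
  shows "generically (\<lambda>v. \<forall>a\<in>A. Q a v)"
  using assms
proof (induction A rule: finite_induct)
  case empty
  then show ?case by (simp add: generically_True)
next
  case (insert a A)
  then show ?case using generically_conj[of "Q a" "\<lambda>v. \<forall>a\<in>A. Q a v"] by simp
qed

lemma generically_distinct_rows:
  fixes i j :: "'n::finite"
  assumes "i \<noteq> j"
  shows "generically (\<lambda>v :: real^'m^'n. v $ i \<noteq> v $ j)"
proof -
  fix l :: 'm
  define P :: "real^'m^'n \<Rightarrow> real" where "P = (\<lambda>v. v $ i $ l + (-1) * v $ j $ l)"
  have "P \<in> polyfun"
    unfolding P_def by (intro polyfun.add polyfun.mult polyfun.coord polyfun.const)
  moreover have "P (\<chi> k. if k = i then 1 else 0) \<noteq> 0"
    using assms by (simp add: P_def)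
  ultimately show ?thesis
    unfolding generically_def
    by (intro bexI[of _ P] conjI exI[of _ "\<chi> k. if k = i then 1 else 0"]) (auto simp: P_def)
qed

text \<open>The four points \<open>x\<close>, \<open>y\<close>, \<open>x\<^sup>*\<close>, \<open>y\<^sup>*\<close> belonging to \<open>w = (v, x, y)\<close>.\<close>

definition pt :: "4 \<Rightarrow> (real^3^8) \<times> (real^3) \<times> (real^3) \<Rightarrow> real^3" where
  "pt j w = (case w of (v, x, y) \<Rightarrow> if j = 1 then x else if j = 2 then y
     else if j = 3 then v $ 7 else v $ 8)"

lemma pt_simps:
  "pt 1 w = fst (snd w)" "pt 2 w = snd (snd w)" "pt 3 w = fst w $ 7" "pt 4 w = fst w $ 8"
  by (auto simp: pt_def split: prod.splits)

definition separated_sols :: "real \<Rightarrow> 4 \<Rightarrow> ((real^3^8) \<times> (real^3) \<times> (real^3)) set" where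
  "separated_sols \<alpha> j0 = {w. snd w \<in> sols \<alpha> (fst w) \<and> (\<forall>j. j \<noteq> j0 \<longrightarrow> pt j w \<noteq> pt j0 w) \<and>
     (\<forall>k\<in>{1,2,3,4,5,6}. fst w $ 7 \<noteq> fst w $ k \<and> fst w $ 8 \<noteq> fst w $ k)}"

lemma pmonom_parameters_and_coordinate:
  fixes u :: "'w \<Rightarrow> (real^3^8) \<times> (real^3) \<times> (real^3)"
  assumes j1: "j1 = 1 \<or> j1 = 2" and e: "\<And>i. e i \<le> D"
  shows "pmonom (case_option (\<lambda>w. pt j1 (u w) $ l1) (\<lambda>(k, l) w. fst (u w) $ k $ l)) e
    \<in> pmonoms (\<lambda>(j, l) w. pt j (u w) $ l) D *
      (\<Prod>k\<in>{1,2,3,4,5,6}. pmonoms (\<lambda>l w. fst (u w) $ k $ l) D)"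
    (is "pmonom ?g e \<in> pmonoms ?\<zeta> D * (\<Prod>k\<in>?K. pmonoms (?t k) D)")
proof -
  define e' :: "4 \<times> 3 \<Rightarrow> nat" where "e' = (\<lambda>(j, l). if j = 3 then e (Some (7, l))
    else if j = 4 then e (Some (8, l)) else if j = j1 \<and> l = l1 then e None else 0)"
  have "pmonom ?g e = ?g None ^ e None * (\<Prod>x\<in>UNIV. ?g (Some x) ^ e (Some x))"
    unfolding pmonom_def UNIV_option_conv by (subst prod.insert) (auto simp: prod.reindex)
  also have "(\<Prod>x\<in>UNIV. ?g (Some x) ^ e (Some x)) = (\<Prod>k\<in>UNIV. pmonom (?t k) (\<lambda>l. e (Some (k, l))))"
    unfolding pmonom_def UNIV_Times_UNIV[symmetric] prod.cartesian_product by (intro prod.cong) auto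
  also have "\<dots> = pmonom (?t 7) (\<lambda>l. e (Some (7, l))) * pmonom (?t 8) (\<lambda>l. e (Some (8, l))) *
      (\<Prod>k\<in>?K. pmonom (?t k) (\<lambda>l. e (Some (k, l))))"
    unfolding UNIV_8 by (simp add: ac_simps)
  finally have 1: "pmonom ?g e = (?g None ^ e None * (pmonom (?t 7) (\<lambda>l. e (Some (7, l))) *
      pmonom (?t 8) (\<lambda>l. e (Some (8, l))))) * (\<Prod>k\<in>?K. pmonom (?t k) (\<lambda>l. e (Some (k, l))))"
    by (simp only: mult.assoc)
  have "pmonom ?\<zeta> e' = (\<Prod>j\<in>UNIV. \<Prod>l\<in>UNIV. ?\<zeta> (j, l) ^ e' (j, l))"
    unfolding pmonom_def UNIV_Times_UNIV[symmetric] prod.cartesian_product by (intro prod.cong) auto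
  also have "\<dots> = (\<Prod>l\<in>UNIV. ?\<zeta> (1, l) ^ e' (1, l)) * (\<Prod>l\<in>UNIV. ?\<zeta> (2, l) ^ e' (2, l)) *
      ((\<Prod>l\<in>UNIV. ?\<zeta> (3, l) ^ e' (3, l)) * (\<Prod>l\<in>UNIV. ?\<zeta> (4, l) ^ e' (4, l)))"
    unfolding UNIV_4 by (simp add: mult.assoc)
  finally have prod\<zeta>: "pmonom ?\<zeta> e' = (\<Prod>l\<in>UNIV. ?\<zeta> (1, l) ^ e' (1, l)) * (\<Prod>l\<in>UNIV. ?\<zeta> (2, l) ^ e' (2, l)) *
      ((\<Prod>l\<in>UNIV. ?\<zeta> (3, l) ^ e' (3, l)) * (\<Prod>l\<in>UNIV. ?\<zeta> (4, l) ^ e' (4, l)))" .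
  have params: "(\<Prod>l\<in>UNIV. ?\<zeta> (3, l) ^ e' (3, l)) = pmonom (?t 7) (\<lambda>l. e (Some (7, l)))"
    "(\<Prod>l\<in>UNIV. ?\<zeta> (4, l) ^ e' (4, l)) = pmonom (?t 8) (\<lambda>l. e (Some (8, l)))"
    by (simp_all add: pmonom_def e'_def pt_simps)
  have coord: "(\<Prod>l\<in>UNIV. ?\<zeta> (1, l) ^ e' (1, l)) * (\<Prod>l\<in>UNIV. ?\<zeta> (2, l) ^ e' (2, l)) = ?g None ^ e None"
    using j1 pmonom_single[of "\<lambda>l. ?\<zeta> (1, l)" l1 "e None"] pmonom_single[of "\<lambda>l. ?\<zeta> (2, l)" l1 "e None"]
    by (auto simp: pmonom_def e'_def)
  have 2: "pmonom ?g e = pmonom ?\<zeta> e' * (\<Prod>k\<in>?K. pmonom (?t k) (\<lambda>l. e (Some (k, l))))"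
    by (simp only: 1 prod\<zeta> params coord)
  show ?thesis
    unfolding 2 by (intro set_times_intro set_prod_mem pmonomsI) (auto simp: e'_def e)
qed

lemma generically_finite_coordinate:
  assumes \<alpha>: "\<alpha> \<in> \<rat>" "\<alpha> < 0" and j1: "j1 = 1 \<or> j1 = 2"
  shows "generically (\<lambda>v. finite {pt j1 w $ l1 | w. w \<in> separated_sols \<alpha> j0 \<and> fst w = v})"
proof (cases "separated_sols \<alpha> j0 = {}")
  case True
  then show ?thesis by (simp add: generically_True)
next
  case False
  then obtain w0 where w0: "w0 \<in> separated_sols \<alpha> j0" by blast
  let ?W = "separated_sols \<alpha> j0" and ?K = "{1, 2, 3, 4, 5, 6 :: 8}"
  define u where "u w = (if w \<in> ?W then w else w0)" for w
  have u: "u w \<in> ?W" for w using w0 by (simp add: u_def)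
  obtain p q :: nat where pq: "\<alpha> = - (real p / real q)" "p > 0" "q > 0"
  proof -
    obtain a b :: nat where "b \<noteq> 0" "\<bar>\<alpha>\<bar> = real a / real b"
      using Rats_abs_nat_div_natE[OF \<alpha>(1)] by metis
    then show ?thesis using that[of a b] \<alpha>(2) by (cases "a = 0") auto
  qed
  define \<epsilon> :: "4 \<Rightarrow> real" where "\<epsilon> j = (if j = 1 \<or> j = 2 then 1 else - 1)" for j
  define g where "g = case_option (\<lambda>w. pt j1 (u w) $ l1) (\<lambda>(k, l) w. fst (u w) $ k $ l)"
  have ne: "pt j (u w) \<noteq> fst (u w) $ k" if "k \<in> ?K" for j k w
    using u[of w] that exhaust_4[of j]
    by (auto simp: separated_sols_def sols_def pt_simps split: prod.splits)
  have eqn: "(\<Sum>j\<in>UNIV. \<epsilon> j * norm (pt j (u w) - fst (u w) $ k) powr \<alpha>) = 0" if "k \<in> ?K" for k w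
    using u[of w] that
    by (auto simp: separated_sols_def sols_def pt_simps sum_4 \<epsilon>_def split: prod.splits)
  have "\<exists>D c. (\<exists>e\<in>{e. \<forall>i. e i \<le> D}. c e \<noteq> 0) \<and>
      (\<forall>w. (\<Sum>e\<in>{e. \<forall>i. e i \<le> D}. c e * (\<Prod>i\<in>UNIV. g i w ^ e i)) = 0)"
  proof (rule dependence_on_separated_piece[OF pq, of ?K j0 "\<lambda>j w. pt j (u w)" "\<lambda>k w. fst (u w) $ k" \<epsilon>])
    show "pt j (u w) \<noteq> pt j0 (u w)" if "j \<noteq> j0" for j w
      using u[of w] that by (simp add: separated_sols_def)
    show "CARD(4 \<times> 3) + (CARD(3) - 1) * card ?K < CARD((8 \<times> 3) option)"
      by (simp add: card_UNIV_option)
    show "\<epsilon> j0 \<noteq> 0" by (simp add: \<epsilon>_def)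
    show "pmonom g e \<in> pmonoms (\<lambda>(j, l) w. pt j (u w) $ l) D *
        (\<Prod>k\<in>?K. pmonoms (\<lambda>l w. fst (u w) $ k $ l) D)" if "\<And>i. e i \<le> D" for D e
      unfolding g_def by (rule pmonom_parameters_and_coordinate[OF j1 that])
  qed (fact ne eqn | simp)+
  then obtain D c e0 where e0: "\<forall>i. e0 i \<le> D" "c e0 \<noteq> 0" and
    dep: "\<And>w. (\<Sum>e\<in>{e. \<forall>i. e i \<le> D}. c e * (\<Prod>i\<in>UNIV. g i w ^ e i)) = 0"
    by blast
  let ?E = "{e :: (8 \<times> 3) option \<Rightarrow> nat. \<forall>i. e i \<le> D}"
  obtain d where
    nz: "\<exists>X. (\<Sum>e\<in>{e\<in>?E. e None = d}. c e * (\<Prod>i\<in>UNIV. X i ^ e (Some i))) \<noteq> 0" and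
    fin: "\<And>X. (\<Sum>e\<in>{e\<in>?E. e None = d}. c e * (\<Prod>i\<in>UNIV. X i ^ e (Some i))) \<noteq> 0 \<Longrightarrow>
      finite {s. (\<Sum>e\<in>?E. c e * (s ^ e None * (\<Prod>i\<in>UNIV. X i ^ e (Some i)))) = 0}"
    using eliminate_variable[OF finite_card_bounded_exponents(1)[of D], of e0 c] e0 by blast
  define P :: "real^3^8 \<Rightarrow> real" where
    "P = (\<lambda>v. \<Sum>e\<in>{e\<in>?E. e None = d}. c e * (\<Prod>i\<in>UNIV. v $ fst i $ snd i ^ e (Some i)))"
  show ?thesis
    unfolding generically_def
  proof (intro bexI conjI allI impI)
    show "P \<in> polyfun"
      unfolding P_def
      by (intro polyfun_sum polyfun.mult polyfun.const polyfun_prod polyfun_power polyfun.coord)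
    from nz obtain X where X: "(\<Sum>e\<in>{e\<in>?E. e None = d}. c e * (\<Prod>i\<in>UNIV. X i ^ e (Some i))) \<noteq> 0" ..
    then show "\<exists>v. P v \<noteq> 0"
      by (intro exI[of _ "\<chi> k l. X (k, l)"]) (simp add: P_def)
    fix v assume "P v \<noteq> 0"
    then have "finite {s. (\<Sum>e\<in>?E. c e * (s ^ e None * (\<Prod>i\<in>UNIV. v $ fst i $ snd i ^ e (Some i)))) = 0}"
      using fin[of "\<lambda>i. v $ fst i $ snd i"] by (simp add: P_def)
    moreover have "{pt j1 w $ l1 | w. w \<in> ?W \<and> fst w = v} \<subseteq>
        {s. (\<Sum>e\<in>?E. c e * (s ^ e None * (\<Prod>i\<in>UNIV. v $ fst i $ snd i ^ e (Some i)))) = 0}"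
    proof clarify
      fix w assume "w \<in> ?W" "v = fst w"
      have "(\<Prod>i\<in>UNIV. g i w ^ e i) = pt j1 w $ l1 ^ e None * (\<Prod>i\<in>UNIV. fst w $ fst i $ snd i ^ e (Some i))" for e
        unfolding UNIV_option_conv using \<open>w \<in> ?W\<close>
        by (subst prod.insert) (auto simp: prod.reindex g_def u_def case_prod_beta)
      then show "(\<Sum>e\<in>?E. c e * (pt j1 w $ l1 ^ e None * (\<Prod>i\<in>UNIV. fst w $ fst i $ snd i ^ e (Some i)))) = 0"
        using dep[of w] by simp
    qed
    ultimately show "finite {pt j1 w $ l1 | w. w \<in> ?W \<and> fst w = v}"
      by (rule finite_subset[rotated])
  qed
qed

lemma finite_vectors_with_coordinates:
  fixes A :: "'n::finite \<Rightarrow> 'a set"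
  assumes "\<And>l. finite (A l)"
  shows "finite {x. \<forall>l. x $ l \<in> A l}"
proof -
  have "{x. \<forall>l. x $ l \<in> A l} \<subseteq> vec_lambda ` PiE UNIV A"
  proof
    fix x assume "x \<in> {x. \<forall>l. x $ l \<in> A l}"
    then have "vec_nth x \<in> PiE UNIV A" by auto
    then show "x \<in> vec_lambda ` PiE UNIV A" by (metis image_eqI vec_nth_inverse)
  qed
  moreover have "finite (vec_lambda ` PiE UNIV A)"
    using assms by (intro finite_imageI finite_PiE) auto
  ultimately show ?thesis by (rule finite_subset)
qed

lemma isolated_point:
  assumes "(x, y) \<noteq> (v $ 7, v $ 8)" "(x, y) \<noteq> (v $ 8, v $ 7)" "v $ 7 \<noteq> v $ 8"
  shows "\<exists>j0. \<forall>j. j \<noteq> j0 \<longrightarrow> pt j (v, x, y) \<noteq> pt j0 (v, x, y)"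
proof -
  let ?iso = "\<lambda>j0. \<forall>j. j \<noteq> j0 \<longrightarrow> pt j (v, x, y) \<noteq> pt j0 (v, x, y)"
  have "?iso 1 \<or> ?iso 2 \<or> ?iso 3 \<or> ?iso 4"
    using assms unfolding forall_4 pt_simps by auto
  then show ?thesis by blast
qed

theorem theorem3p1:
  fixes \<alpha> :: real
  assumes "\<alpha> \<in> \<rat>" and "\<alpha> < 0"
  shows "\<exists>P \<in> (polyfun :: (real^3^8 \<Rightarrow> real) set). (\<exists>v. P v \<noteq> 0) \<and>
           (\<forall>v. P v \<noteq> 0 \<longrightarrow> finite (sols \<alpha> v))"
proof -
  let ?K = "{1, 2, 3, 4, 5, 6 :: 8}"
  define A where "A j0 j l v = {pt j w $ l | w. w \<in> separated_sols \<alpha> j0 \<and> fst w = v}" for j0 j l v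
  have "generically (\<lambda>v. v $ 7 \<noteq> v $ 8 \<and> (\<forall>k\<in>?K. v $ 7 \<noteq> v $ k \<and> v $ 8 \<noteq> v $ k) \<and>
      (\<forall>j0\<in>UNIV. \<forall>j\<in>{1, 2}. \<forall>l\<in>UNIV. finite (A j0 j l v)))"
    unfolding A_def
    by (intro generically_conj generically_ball generically_distinct_rows
        generically_finite_coordinate assms) auto
  then have "generically (\<lambda>v. finite (sols \<alpha> v))"
  proof (rule generically_mono)
    fix v :: "real^3^8"
    assume v: "v $ 7 \<noteq> v $ 8 \<and> (\<forall>k\<in>?K. v $ 7 \<noteq> v $ k \<and> v $ 8 \<noteq> v $ k) \<and>
      (\<forall>j0\<in>UNIV. \<forall>j\<in>{1, 2}. \<forall>l\<in>UNIV. finite (A j0 j l v))"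
    let ?B = "\<lambda>j0 j. {x. \<forall>l. x $ l \<in> A j0 j l v}"
    have "sols \<alpha> v \<subseteq> {(v $ 7, v $ 8), (v $ 8, v $ 7)} \<union> (\<Union>j0. ?B j0 1 \<times> ?B j0 2)"
    proof
      fix s assume s: "s \<in> sols \<alpha> v"
      obtain x y where xy: "s = (x, y)" by (cases s)
      show "s \<in> {(v $ 7, v $ 8), (v $ 8, v $ 7)} \<union> (\<Union>j0. ?B j0 1 \<times> ?B j0 2)"
      proof (cases "s \<in> {(v $ 7, v $ 8), (v $ 8, v $ 7)}")
        case False
        then obtain j0 where j0: "\<forall>j. j \<noteq> j0 \<longrightarrow> pt j (v, x, y) \<noteq> pt j0 (v, x, y)"
          using isolated_point[of x y v] v xy by auto
        then have "(v, x, y) \<in> separated_sols \<alpha> j0"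
          using s v xy by (simp add: separated_sols_def)
        then have "x \<in> ?B j0 1" "y \<in> ?B j0 2"
          unfolding A_def using pt_simps(1,2)[of "(v, x, y)"] by force+
        then show ?thesis using xy by blast
      qed blast
    qed
    moreover have "finite ({(v $ 7, v $ 8), (v $ 8, v $ 7)} \<union> (\<Union>j0. ?B j0 1 \<times> ?B j0 2))"
      using v by (intro finite_UnI finite_UN_I finite_cartesian_product finite_vectors_with_coordinates) auto
    ultimately show "finite (sols \<alpha> v)" by (rule finite_subset)
  qed
  then show ?thesis unfolding generically_def .
qed

end
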